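(* Let $((G_n,M_n))_n$ be a weakly convergent sequence of measure graphs with uniform vertex degree bound $D\in\mathbb N$. Let $B_{(D-1)^{-1}}=\{u\in\mathbb C:|u|<(D-1)^{-1}\}$. Then there exists a holomorphic function $Z:B_{(D-1)^{-1}}\to\mathbb C$ such that $Z_{(G_n,M_n)}\to Z$ uniformly on compact subsets of $B_{(D-1)^{-1}}$. The function $Z$ is given by $$Z(u)=\exp\Bigl(\sum_{j\ge1}\frac{F_j}{j}u^j\Bigr),\qquad F_j=\sum_{\alpha\in\mathcal A^D_j}N_j(\alpha)\,p(\alpha)+\sum_{r=0}^{j-1}\sum_{\alpha\in\mathcal A^D_r}N_j(\alpha)\,p^{\rm fin}(\alpha).$$ In particular, if a measure graph $(G,M)$ is a weak limit of $((G_n,M_n))$, then $Z=Z_{(G,M)}$.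
   Context: GRAPHS. A graph $G=(V,E)$ has a nonempty vertex set $V$ (of arbitrary cardinality), a symmetric edge set $E\subseteq V\times V$ containing no $(x,x)$, and vertex degrees uniformly bounded by some $D>0$. Write $x\sim y$ if $(x,y)\in E$, $x\approx y$ if $x,y$ lie in the same connected component, $d$ for the combinatorial distance, $G(x)$ for the connected component of $x$. $B^G_r(x)$ is the graph induced on $\{y:d(x,y)\le r\}$, rooted at $x$. The radius $\rho$ of a finite connected rooted graph is the maximal distance of a vertex from the root. $\mathcal A_r^D$ is the set of isomorphism classes of finite connected rooted graphs with degrees at most $D$ and radius exactly $r$; $\mathcal A^D=\bigcup_{r\ge0}\mathcal A^D_r$ (discrete $\sigma$-algebra); $\pi_r(x)=[B_r^G(x)]$. $V^{(2)}=\{(x,y)\in V\times V:x\approx y\}$, and $a_G:V^{(2)}\to\{0,1\}$ is the adjacency matrix. For $\alpha\in\mathcal A^D$: $V_\alpha=\{x\in V:\pi_{\rho(\alpha)}(x)=\alpha\}$; $V^{{\rm fin},r}=\{x\in V:G(x)\text{ is finite and }\rho((G(x),x))=r\}$; $V^{{\rm fin},r}_\alpha=V^{{\rm fin},r}\cap V_\alpha$. MEASURABLE GRAPH: a graph with a $\sigma$-algebra on $V$ (and $V^{(2)}$ with the $\sigma$-algebra induced from the product) such that all $\pi_r$ and $a_G$ are measurable and for all measurable $a,b:V^{(2)}\to[0,\infty]$ the product $(a*b)(x,y)=\sum_{z\approx x}a(x,z)b(z,y)$ is measurable. GROUPOID: $\mathcal G$ is a groupoid (small category with all morphisms invertible)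 with range $r(g)=gg^{-1}$, source $s(g)=g^{-1}g$, unit set $\Omega=\mathcal G^{(0)}$, $\mathcal G^\omega=r^{-1}(\{\omega\})$; it is measurable: it carries a $\sigma$-algebra for which multiplication, inversion, $r,s$ are measurable and singletons in $\Omega$ are measurable. A transversal function is a family $\nu=(\nu^\omega)_{\omega\in\Omega}$ of measures on $\mathcal G$ with $\nu^\omega$ supported on $\mathcal G^\omega$, $\omega\mapsto\nu^\omega(f)$ measurable for measurable $f\ge0$, and $\int f(gh)\,d\nu^{s(g)}(h)=\int f(k)\,d\nu^{r(g)}(k)$ for all $g$ and measurable $f\ge 0$ on $\mathcal G^{r(g)}$. A measure $m$ on $\Omega$ is $\nu$-invariant if $m\circ\nu=\int\nu^\omega dm(\omega)$ is invariant under $g\mapsto g^{-1}$. GRAPH OVER $\mathcal G$: a measurable graph $G$ with a measurable map $\pi:V\to\Omega$ with countable fibers $V^\omega=\pi^{-1}(\{\omega\})$, such that $\eta^\omega:=\sum_{y\in V^\omega}\delta_y$ satisfies that $\omega\mapsto\eta^\omega(F)$ is measurable for each measurable $F:V\to[0,\infty]$, and with graph isomorphisms $J(g):G^{s(g)}\to G^{r(g)}$, $g\in\mathcal G$, between the induced graphs $G^\omega$ on the fibers $V^\omega$, satisfying $J(g^{-1})=J(g)^{-1}$ and $J(g_1g_2)=J(g_1)J(g_2)$ if $s(g_1)=r(g_2)$; write $gx=J(g)x$. The action $(g,x)\mapsto gx$ is measurable. AVERAGING FUNCTION: measurable $\mathfrak u:V\to[0,\infty]$ with $\int_{\mathcal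 G^{\pi(x)}}\mathfrak u(g^{-1}x)\,d\nu^{\pi(x)}(g)=1$ for all $x\in V$. MEASURE GRAPH over $\mathcal G$: a pair $(G,M)$ where $G$ is a graph over the measurable groupoid $\mathcal G$ with transversal function $\nu$ and $\nu$-invariant measure $m$, $M=m\circ\eta=\int\eta^\omega\,dm(\omega)$, the $\sigma$-algebras of $V$ and $\Omega$ have countable bases of sets of finite $M$- resp. $m$-measure, there is a strictly positive averaging function $\mathfrak u$, and $\int_V\mathfrak u\,dM<\infty$. Different measure graphs may be over different groupoids. ZETA FUNCTION. A path of length $n$ is a sequence of edges $(e_1,\dots,e_n)$ with terminal vertex of $e_i$ equal to origin of $e_{i+1}$; it is closed if the terminal vertex of $e_n$ is the origin of $e_1$. With $\bar e$ the reversed edge, a closed path is reduced if $e_{i+1}\ne\bar e_i$ for $1\le i\le n-1$ and $\bar e_1\neq e_n$. $N_j^G(x)$ is the number of reduced closed paths of length $j$ in $G$ starting at $x$; for $\alpha=[(H,x)]\in\mathcal A^D$, $N_j(\alpha):=N_j^H(x)$. $\overline N_j=\int_VN_j^G\,\mathfrak u\,dM$ (independent of the averaging function $\mathfrak u$); $Z_{(G,M)}(u)=\exp\bigl(\sum_{j\ge1}\frac{\overline N_j}{j}u^j\bigr)$. WEAK CONVERGENCE. A sequence $((G_n,M_n))$ of measure graphs with uniform vertex degree bound $D$, vertex sets $V_n$ and averaging functions $\mathfrak u_n$ is weakly convergent if $p(\alpha):=\lim_{n}\int_{V_{n,\alpha}}\mathfrak u_n\,dM_n$ exists for every $\alpha\in\mathcal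 A^D$. A measure graph $(G,M)$ with vertex set $V$ and averaging function $\mathfrak u$ is a weak limit if $p(\alpha)=\int_{V_\alpha}\mathfrak u\,dM$ for all $\alpha\in\mathcal A^D$. For a weakly convergent sequence, $p^{\rm fin}(\alpha):=\lim_n\int_{V_{n,\alpha}^{{\rm fin},\rho(\alpha)}}\mathfrak u_n\,dM_n$ (this limit exists).
   Formalization: A weak limit is additionally required to have vertex degrees at most D; without this the last claim fails (D = 1, G_n single vertices, limit K_3 with total mass 1). *)

theory Defs
  imports "HOL-Analysis.Analysis"
begin

record 'v graph =
  verts :: "'v set"
  edges :: "('v \<times> 'v) set"

definition degree_bounded :: "nat \<Rightarrow> 'v graph \<Rightarrow> bool" where
  "degree_bounded D G \<longleftrightarrow>
     (\<forall>x\<in>verts G. finite (edges G `` {x}) \<and> card (edges G `` {x}) \<le> D)"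

definition is_graph :: "'v graph \<Rightarrow> bool" where
  "is_graph G \<longleftrightarrow>
     verts G \<noteq> {} \<and> edges G \<subseteq> verts G \<times> verts G \<and> sym (edges G) \<and>
     (\<forall>x. (x, x) \<notin> edges G) \<and> (\<exists>D>0. degree_bounded D G)"

definition induced :: "'v graph \<Rightarrow> 'v set \<Rightarrow> 'v graph" where
  "induced G W = \<lparr>verts = verts G \<inter> W, edges = edges G \<inter> W \<times> W\<rparr>"

definition conn :: "'v graph \<Rightarrow> ('v \<times> 'v) set" where
  "conn G = {(x, y). x \<in> verts G \<and> y \<in> verts G \<and> (x, y) \<in> (edges G)\<^sup>*}"

text \<open>Only meaningful for vertices in the same connected component.\<close>

definition gdist :: "'v graph \<Rightarrow> 'v \<Rightarrow> 'v \<Rightarrow> nat" where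
  "gdist G x y = (LEAST n. (x, y) \<in> edges G ^^ n)"

definition component :: "'v graph \<Rightarrow> 'v \<Rightarrow> 'v graph" where
  "component G x = induced G {y. (x, y) \<in> conn G}"

definition connected_graph :: "'v graph \<Rightarrow> bool" where
  "connected_graph G \<longleftrightarrow> (\<forall>x\<in>verts G. \<forall>y\<in>verts G. (x, y) \<in> conn G)"

definition graph_iso :: "('v \<Rightarrow> 'w) \<Rightarrow> 'v graph \<Rightarrow> 'w graph \<Rightarrow> bool" where
  "graph_iso f G H \<longleftrightarrow>
     bij_betw f (verts G) (verts H) \<and>
     (\<forall>x\<in>verts G. \<forall>y\<in>verts G. (x, y) \<in> edges G \<longleftrightarrow> (f x, f y) \<in> edges H)"

type_synonym 'v rooted = "'v graph \<times> 'v"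

definition is_rooted :: "'v rooted \<Rightarrow> bool" where
  "is_rooted = (\<lambda>(G, x). is_graph G \<and> x \<in> verts G)"

definition rooted_ball :: "'v graph \<Rightarrow> nat \<Rightarrow> 'v \<Rightarrow> 'v rooted" where
  "rooted_ball G r x = (induced G {y. (x, y) \<in> conn G \<and> gdist G x y \<le> r}, x)"

definition rooted_component :: "'v graph \<Rightarrow> 'v \<Rightarrow> 'v rooted" where
  "rooted_component G x = (component G x, x)"

definition radius :: "'v rooted \<Rightarrow> nat" where
  "radius = (\<lambda>(H, x). Max (gdist H x ` verts H))"

definition rooted_iso :: "'v rooted \<Rightarrow> 'w rooted \<Rightarrow> bool" where
  "rooted_iso = (\<lambda>(G, x) (H, y). \<exists>f. graph_iso f G H \<and> f x = y)"

text \<open>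
  Every finite graph is isomorphic to one whose vertices are natural numbers.  The isomorphism
  class of a finite rooted graph over any type is therefore represented by the set of all its
  copies on natural numbers, so that classes coming from different vertex types can be compared.
\<close>

type_synonym rclass = "nat rooted set"

definition iso_class :: "'v rooted \<Rightarrow> rclass" where
  "iso_class H = {K. is_rooted K \<and> rooted_iso K H}"

definition classes_radius :: "nat \<Rightarrow> nat \<Rightarrow> rclass set" where
  "classes_radius D r =
     {iso_class H | H :: nat rooted.
        is_rooted H \<and> finite (verts (fst H)) \<and> connected_graph (fst H) \<and>
        degree_bounded D (fst H) \<and> radius H = r}"

definition classes :: "nat \<Rightarrow> rclass set" where
  "classes D = (\<Union>r. classes_radius D r)"

definition class_radius :: "rclass \<Rightarrow> nat" where
  "class_radius \<alpha> = radius (SOME H. H \<in> \<alpha>)"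

definition ball_class :: "'v graph \<Rightarrow> nat \<Rightarrow> 'v \<Rightarrow> rclass" where
  "ball_class G r x = iso_class (rooted_ball G r x)"

definition verts_class :: "'v graph \<Rightarrow> rclass \<Rightarrow> 'v set" where
  "verts_class G \<alpha> = {x \<in> verts G. ball_class G (class_radius \<alpha>) x = \<alpha>}"

definition verts_fin :: "'v graph \<Rightarrow> nat \<Rightarrow> 'v set" where
  "verts_fin G r =
     {x \<in> verts G. finite (verts (component G x)) \<and> radius (rooted_component G x) = r}"

definition is_path :: "'v graph \<Rightarrow> ('v \<times> 'v) list \<Rightarrow> bool" where
  "is_path G es \<longleftrightarrow>
     set es \<subseteq> edges G \<and> (\<forall>i. Suc i < length es \<longrightarrow> snd (es ! i) = fst (es ! Suc i))"

definition reduced_closed_path :: "'v graph \<Rightarrow> ('v \<times> 'v) list \<Rightarrow> bool" where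
  "reduced_closed_path G es \<longleftrightarrow>
     is_path G es \<and> es \<noteq> [] \<and> snd (last es) = fst (hd es) \<and>
     (\<forall>i. Suc i < length es \<longrightarrow> es ! Suc i \<noteq> prod.swap (es ! i)) \<and>
     prod.swap (hd es) \<noteq> last es"

definition num_rcp :: "'v graph \<Rightarrow> nat \<Rightarrow> 'v \<Rightarrow> nat" where
  "num_rcp G j x = card {es. reduced_closed_path G es \<and> length es = j \<and> fst (hd es) = x}"

definition class_num_rcp :: "nat \<Rightarrow> rclass \<Rightarrow> nat" where
  "class_num_rcp j \<alpha> = (case (SOME H. H \<in> \<alpha>) of (H, x) \<Rightarrow> num_rcp H j x)"

text \<open>
  A \<open>\<sigma>\<close>-algebra is given by a term of type \<open>measure\<close>, of which the definitions up to the
  notion of averaging function use only the space and the measurable sets.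
\<close>

definition mk_graph :: "'v measure \<Rightarrow> ('v \<times> 'v) set \<Rightarrow> 'v graph" where
  "mk_graph V E = \<lparr>verts = space V, edges = E\<rparr>"

definition pair_algebra :: "'v measure \<Rightarrow> ('v \<times> 'v) set \<Rightarrow> ('v \<times> 'v) measure" where
  "pair_algebra V E = restrict_space (V \<Otimes>\<^sub>M V) (conn (mk_graph V E))"

definition convol ::
    "'v graph \<Rightarrow> ('v \<times> 'v \<Rightarrow> ennreal) \<Rightarrow> ('v \<times> 'v \<Rightarrow> ennreal) \<Rightarrow> 'v \<times> 'v \<Rightarrow> ennreal" where
  "convol G a b = (\<lambda>(x, y). \<Sum>\<^sub>\<infinity>z\<in>{z. (x, z) \<in> conn G}. a (x, z) * b (z, y))"

text \<open>
  The balls in a graph with degrees bounded by \<open>D\<close> have their classes in \<^term>\<open>classes D\<close>, so the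
  discrete \<open>\<sigma>\<close>-algebra on the whole type gives the same condition as the one on \<^term>\<open>classes D\<close>.
\<close>

definition measurable_graph :: "'v measure \<Rightarrow> ('v \<times> 'v) set \<Rightarrow> bool" where
  "measurable_graph V E \<longleftrightarrow>
     is_graph (mk_graph V E) \<and>
     (\<forall>r. ball_class (mk_graph V E) r \<in> V \<rightarrow>\<^sub>M count_space UNIV) \<and>
     (indicator E :: 'v \<times> 'v \<Rightarrow> real) \<in> borel_measurable (pair_algebra V E) \<and>
     (\<forall>a \<in> borel_measurable (pair_algebra V E). \<forall>b \<in> borel_measurable (pair_algebra V E).
        convol (mk_graph V E) a b \<in> borel_measurable (pair_algebra V E))"

text \<open>
  A groupoid is given by its arrows; objects are identified with the corresponding identity
  arrows.  The value of \<open>gmult g h\<close> matters only if the source of \<open>g\<close> is the range of \<open>h\<close>.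
\<close>

record 'g groupoid =
  arrows :: "'g measure"
  gmult :: "'g \<Rightarrow> 'g \<Rightarrow> 'g"
  ginv :: "'g \<Rightarrow> 'g"

definition grange :: "'g groupoid \<Rightarrow> 'g \<Rightarrow> 'g" where
  "grange \<G> g = gmult \<G> g (ginv \<G> g)"

definition gsource :: "'g groupoid \<Rightarrow> 'g \<Rightarrow> 'g" where
  "gsource \<G> g = gmult \<G> (ginv \<G> g) g"

definition composable :: "'g groupoid \<Rightarrow> ('g \<times> 'g) set" where
  "composable \<G> =
     {(g, h). g \<in> space (arrows \<G>) \<and> h \<in> space (arrows \<G>) \<and> gsource \<G> g = grange \<G> h}"

text \<open>
  The third clause makes \<open>g\<close> and its inverse composable in both orders; with the second it yields
  that \<^term>\<open>grange \<G> g\<close> and \<^term>\<open>gsource \<G> g\<close> are arrows that are their own range and source.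
\<close>

definition is_groupoid :: "'g groupoid \<Rightarrow> bool" where
  "is_groupoid \<G> \<longleftrightarrow>
     (\<forall>g \<in> space (arrows \<G>). ginv \<G> g \<in> space (arrows \<G>)) \<and>
     (\<forall>(g, h) \<in> composable \<G>.
        gmult \<G> g h \<in> space (arrows \<G>) \<and>
        grange \<G> (gmult \<G> g h) = grange \<G> g \<and> gsource \<G> (gmult \<G> g h) = gsource \<G> h) \<and>
     (\<forall>g \<in> space (arrows \<G>).
        grange \<G> (ginv \<G> g) = gsource \<G> g \<and> gsource \<G> (ginv \<G> g) = grange \<G> g) \<and>
     (\<forall>g \<in> space (arrows \<G>).
        gmult \<G> (grange \<G> g) g = g \<and> gmult \<G> g (gsource \<G> g) = g) \<and>
     (\<forall>g h k. (g, h) \<in> composable \<G> \<longrightarrow> (h, k) \<in> composable \<G> \<longrightarrow>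
        gmult \<G> (gmult \<G> g h) k = gmult \<G> g (gmult \<G> h k))"

definition units :: "'g groupoid \<Rightarrow> 'g set" where
  "units \<G> = grange \<G> ` space (arrows \<G>)"

definition unit_algebra :: "'g groupoid \<Rightarrow> 'g measure" where
  "unit_algebra \<G> = restrict_space (arrows \<G>) (units \<G>)"

definition gfiber :: "'g groupoid \<Rightarrow> 'g \<Rightarrow> 'g set" where
  "gfiber \<G> \<omega> = {g \<in> space (arrows \<G>). grange \<G> g = \<omega>}"

definition measurable_groupoid :: "'g groupoid \<Rightarrow> bool" where
  "measurable_groupoid \<G> \<longleftrightarrow>
     is_groupoid \<G> \<and>
     (\<lambda>(g, h). gmult \<G> g h) \<in>
        restrict_space (arrows \<G> \<Otimes>\<^sub>M arrows \<G>) (composable \<G>) \<rightarrow>\<^sub>M arrows \<G> \<and>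
     ginv \<G> \<in> arrows \<G> \<rightarrow>\<^sub>M arrows \<G> \<and>
     grange \<G> \<in> arrows \<G> \<rightarrow>\<^sub>M unit_algebra \<G> \<and>
     gsource \<G> \<in> arrows \<G> \<rightarrow>\<^sub>M unit_algebra \<G> \<and>
     (\<forall>\<omega>\<in>units \<G>. {\<omega>} \<in> sets (unit_algebra \<G>))"

definition transversal_function :: "'g groupoid \<Rightarrow> ('g \<Rightarrow> 'g measure) \<Rightarrow> bool" where
  "transversal_function \<G> \<nu> \<longleftrightarrow>
     (\<forall>\<omega>\<in>units \<G>.
        space (\<nu> \<omega>) = space (arrows \<G>) \<and> sets (\<nu> \<omega>) = sets (arrows \<G>) \<and>
        emeasure (\<nu> \<omega>) (space (arrows \<G>) - gfiber \<G> \<omega>) = 0) \<and>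
     (\<forall>f :: 'g \<Rightarrow> ennreal. f \<in> borel_measurable (arrows \<G>) \<longrightarrow>
        (\<lambda>\<omega>. \<integral>\<^sup>+ g. f g \<partial>\<nu> \<omega>) \<in> borel_measurable (unit_algebra \<G>)) \<and>
     (\<forall>g \<in> space (arrows \<G>). \<forall>f :: 'g \<Rightarrow> ennreal.
        f \<in> borel_measurable (restrict_space (arrows \<G>) (gfiber \<G> (grange \<G> g))) \<longrightarrow>
        (\<integral>\<^sup>+ h\<in>gfiber \<G> (gsource \<G> g). f (gmult \<G> g h) \<partial>\<nu> (gsource \<G> g)) =
        (\<integral>\<^sup>+ k\<in>gfiber \<G> (grange \<G> g). f k \<partial>\<nu> (grange \<G> g)))"

definition invariant_measure ::
    "'g groupoid \<Rightarrow> ('g \<Rightarrow> 'g measure) \<Rightarrow> 'g measure \<Rightarrow> bool" where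
  "invariant_measure \<G> \<nu> m \<longleftrightarrow>
     space m = units \<G> \<and> sets m = sets (unit_algebra \<G>) \<and>
     (\<forall>A \<in> sets (arrows \<G>).
        (\<integral>\<^sup>+ \<omega>. emeasure (\<nu> \<omega>) (ginv \<G> -` A \<inter> space (arrows \<G>)) \<partial>m) =
        (\<integral>\<^sup>+ \<omega>. emeasure (\<nu> \<omega>) A \<partial>m))"

definition vfiber :: "'v measure \<Rightarrow> ('v \<Rightarrow> 'g) \<Rightarrow> 'g \<Rightarrow> 'v set" where
  "vfiber V \<pi> \<omega> = {x \<in> space V. \<pi> x = \<omega>}"

text \<open>The sum of the Dirac measures at the points of the fiber, as a measure on \<open>V\<close>.\<close>

definition fiber_count :: "'v measure \<Rightarrow> ('v \<Rightarrow> 'g) \<Rightarrow> 'g \<Rightarrow> 'v measure" where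
  "fiber_count V \<pi> \<omega> = distr (count_space (vfiber V \<pi> \<omega>)) V (\<lambda>y. y)"

definition graph_over ::
    "'g groupoid \<Rightarrow> 'v measure \<Rightarrow> ('v \<times> 'v) set \<Rightarrow> ('v \<Rightarrow> 'g) \<Rightarrow> ('g \<Rightarrow> 'v \<Rightarrow> 'v) \<Rightarrow> bool" where
  "graph_over \<G> V E \<pi> J \<longleftrightarrow>
     measurable_graph V E \<and>
     \<pi> \<in> V \<rightarrow>\<^sub>M unit_algebra \<G> \<and>
     (\<forall>\<omega>\<in>units \<G>. countable (vfiber V \<pi> \<omega>)) \<and>
     (\<forall>F :: 'v \<Rightarrow> ennreal. F \<in> borel_measurable V \<longrightarrow>
        (\<lambda>\<omega>. \<integral>\<^sup>+ y. F y \<partial>fiber_count V \<pi> \<omega>) \<in> borel_measurable (unit_algebra \<G>)) \<and>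
     (\<forall>g \<in> space (arrows \<G>).
        graph_iso (J g) (induced (mk_graph V E) (vfiber V \<pi> (gsource \<G> g)))
                        (induced (mk_graph V E) (vfiber V \<pi> (grange \<G> g)))) \<and>
     (\<forall>g \<in> space (arrows \<G>). \<forall>x \<in> vfiber V \<pi> (gsource \<G> g). J (ginv \<G> g) (J g x) = x) \<and>
     (\<forall>(g, h) \<in> composable \<G>. \<forall>x \<in> vfiber V \<pi> (gsource \<G> h).
        J (gmult \<G> g h) x = J g (J h x)) \<and>
     (\<lambda>(g, x). J g x) \<in>
        restrict_space (arrows \<G> \<Otimes>\<^sub>M V)
          {(g, x). g \<in> space (arrows \<G>) \<and> x \<in> vfiber V \<pi> (gsource \<G> g)} \<rightarrow>\<^sub>M V"

definition is_averaging ::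
    "'g groupoid \<Rightarrow> ('g \<Rightarrow> 'g measure) \<Rightarrow> 'v measure \<Rightarrow> ('v \<Rightarrow> 'g) \<Rightarrow> ('g \<Rightarrow> 'v \<Rightarrow> 'v) \<Rightarrow>
     ('v \<Rightarrow> ennreal) \<Rightarrow> bool" where
  "is_averaging \<G> \<nu> V \<pi> J u \<longleftrightarrow>
     u \<in> borel_measurable V \<and>
     (\<forall>x \<in> space V. (\<integral>\<^sup>+ g\<in>gfiber \<G> (\<pi> x). u (J (ginv \<G> g) x) \<partial>\<nu> (\<pi> x)) = 1)"

text \<open>The field \<open>vmeas\<close> is the measure \<open>M\<close>; it also carries \<open>V\<close> and its \<open>\<sigma>\<close>-algebra.\<close>

record ('g, 'v) measure_graph =
  grpd :: "'g groupoid"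
  transv :: "'g \<Rightarrow> 'g measure"
  unit_meas :: "'g measure"
  vmeas :: "'v measure"
  vedges :: "('v \<times> 'v) set"
  vproj :: "'v \<Rightarrow> 'g"
  vact :: "'g \<Rightarrow> 'v \<Rightarrow> 'v"

definition graph_of :: "('g, 'v) measure_graph \<Rightarrow> 'v graph" where
  "graph_of X = mk_graph (vmeas X) (vedges X)"

definition averaging_function :: "('g, 'v) measure_graph \<Rightarrow> ('v \<Rightarrow> ennreal) \<Rightarrow> bool" where
  "averaging_function X u \<longleftrightarrow>
     is_averaging (grpd X) (transv X) (vmeas X) (vproj X) (vact X) u"

definition generated_by_finite_sets :: "'a measure \<Rightarrow> bool" where
  "generated_by_finite_sets M \<longleftrightarrow>
     (\<exists>C. countable C \<and> C \<subseteq> sets M \<and> (\<forall>A\<in>C. emeasure M A < \<infinity>) \<and>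
          sets M = sigma_sets (space M) C)"

definition is_measure_graph :: "('g, 'v) measure_graph \<Rightarrow> bool" where
  "is_measure_graph X \<longleftrightarrow>
     measurable_groupoid (grpd X) \<and>
     transversal_function (grpd X) (transv X) \<and>
     invariant_measure (grpd X) (transv X) (unit_meas X) \<and>
     graph_over (grpd X) (vmeas X) (vedges X) (vproj X) (vact X) \<and>
     (\<forall>A \<in> sets (vmeas X). emeasure (vmeas X) A =
        (\<integral>\<^sup>+ \<omega>. emeasure (fiber_count (vmeas X) (vproj X) \<omega>) A \<partial>unit_meas X)) \<and>
     generated_by_finite_sets (vmeas X) \<and>
     generated_by_finite_sets (unit_meas X) \<and>
     (\<exists>u. averaging_function X u \<and> (\<forall>x \<in> space (vmeas X). u x > 0) \<and>
          (\<integral>\<^sup>+ x. u x \<partial>vmeas X) < \<infinity>)"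

definition mean_rcp :: "('g, 'v) measure_graph \<Rightarrow> ('v \<Rightarrow> ennreal) \<Rightarrow> nat \<Rightarrow> ennreal" where
  "mean_rcp X u j = (\<integral>\<^sup>+ x. of_nat (num_rcp (graph_of X) j x) * u x \<partial>vmeas X)"

definition zeta :: "('g, 'v) measure_graph \<Rightarrow> ('v \<Rightarrow> ennreal) \<Rightarrow> complex \<Rightarrow> complex" where
  "zeta X u z =
     exp (\<Sum>j. complex_of_real (enn2real (mean_rcp X u (Suc j)) / real (Suc j)) * z ^ Suc j)"

definition class_mass :: "('g, 'v) measure_graph \<Rightarrow> ('v \<Rightarrow> ennreal) \<Rightarrow> rclass \<Rightarrow> ennreal" where
  "class_mass X u \<alpha> = (\<integral>\<^sup>+ x\<in>verts_class (graph_of X) \<alpha>. u x \<partial>vmeas X)"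

definition class_mass_fin ::
    "('g, 'v) measure_graph \<Rightarrow> ('v \<Rightarrow> ennreal) \<Rightarrow> rclass \<Rightarrow> ennreal" where
  "class_mass_fin X u \<alpha> =
     (\<integral>\<^sup>+ x\<in>verts_fin (graph_of X) (class_radius \<alpha>) \<inter> verts_class (graph_of X) \<alpha>.
        u x \<partial>vmeas X)"

text \<open>Existence of the limit means existence as a real number, not in \<open>[0, \<infinity>]\<close>.\<close>

definition weakly_convergent ::
    "nat \<Rightarrow> (nat \<Rightarrow> ('g, 'v) measure_graph) \<Rightarrow> (nat \<Rightarrow> 'v \<Rightarrow> ennreal) \<Rightarrow> bool" where
  "weakly_convergent D G u \<longleftrightarrow>
     (\<forall>\<alpha>\<in>classes D. \<exists>L. L < \<infinity> \<and> (\<lambda>n. class_mass (G n) (u n) \<alpha>) \<longlonglongrightarrow> L)"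

definition lim_mass ::
    "(nat \<Rightarrow> ('g, 'v) measure_graph) \<Rightarrow> (nat \<Rightarrow> 'v \<Rightarrow> ennreal) \<Rightarrow> rclass \<Rightarrow> real" where
  "lim_mass G u \<alpha> = enn2real (lim (\<lambda>n. class_mass (G n) (u n) \<alpha>))"

definition lim_mass_fin ::
    "(nat \<Rightarrow> ('g, 'v) measure_graph) \<Rightarrow> (nat \<Rightarrow> 'v \<Rightarrow> ennreal) \<Rightarrow> rclass \<Rightarrow> real" where
  "lim_mass_fin G u \<alpha> = enn2real (lim (\<lambda>n. class_mass_fin (G n) (u n) \<alpha>))"

text \<open>
  The degrees of the limit graph are required to satisfy the same bound: a vertex of degree greater
  than \<open>D\<close> is not seen by any class of positive radius in \<^term>\<open>classes D\<close>.
\<close>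

definition weak_limit ::
    "nat \<Rightarrow> (nat \<Rightarrow> ('g, 'v) measure_graph) \<Rightarrow> (nat \<Rightarrow> 'v \<Rightarrow> ennreal) \<Rightarrow>
     ('h, 'w) measure_graph \<Rightarrow> ('w \<Rightarrow> ennreal) \<Rightarrow> bool" where
  "weak_limit D G u H w \<longleftrightarrow>
     degree_bounded D (graph_of H) \<and>
     (\<forall>\<alpha>\<in>classes D. class_mass H w \<alpha> = ennreal (lim_mass G u \<alpha>))"

definition lim_coeff ::
    "nat \<Rightarrow> (nat \<Rightarrow> ('g, 'v) measure_graph) \<Rightarrow> (nat \<Rightarrow> 'v \<Rightarrow> ennreal) \<Rightarrow> nat \<Rightarrow> real" where
  "lim_coeff D G u j =
     (\<Sum>\<alpha>\<in>classes_radius D j. real (class_num_rcp j \<alpha>) * lim_mass G u \<alpha>) +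
     (\<Sum>r<j. \<Sum>\<alpha>\<in>classes_radius D r. real (class_num_rcp j \<alpha>) * lim_mass_fin G u \<alpha>)"

text \<open>In the extended reals \<open>inverse 0 = \<infinity>\<close>, so the disc is the whole plane if \<open>D = 1\<close>.\<close>

definition zeta_disc :: "nat \<Rightarrow> complex set" where
  "zeta_disc D = {z. ereal (cmod z) < inverse (ereal (real D - 1))}"

end

theory Submission
  imports Defs
begin

text \<open>
  The logarithm of each zeta function is a power series, whose coefficients are integrals of numbers
  of reduced closed paths.  The theorem holds because these coefficients converge separately and are
  dominated by a geometric sequence with ratio \<open>D - 1\<close>.

  Convergence of the coefficients.  A path of length \<open>j\<close> from \<open>x\<close> stays in the ball of radius \<open>j\<close>
  around \<open>x\<close>, so the number of reduced closed paths depends only on the isomorphism class of this ball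
  (lemma \<open>class_num_rcp_ball_class\<close>), and there are only finitely many classes
  (\<open>finite_classes_radius\<close>).  The radius of the ball is either \<open>j\<close>, or some \<open>r < j\<close>.  In the second case
  the component of \<open>x\<close> has no vertex at distance \<open>r + 1\<close>, so the ball is the whole component.  Sorting
  the vertices in this way gives the formula \<open>mean_rcp_eq\<close>, which expresses the coefficients by masses
  of classes and masses of finite components.  The former converge by assumption.  The latter converge
  because a ball of radius \<open>r\<close> is the whole component unless the ball of radius \<open>r + 1\<close> has radius exactly
  \<open>r + 1\<close>: the mass of finite components with class \<open>\<alpha>\<close> is the mass of \<open>\<alpha>\<close> minus the sum of the masses of
  all classes of radius \<open>r + 1\<close> that extend \<open>\<alpha>\<close> (\<open>class_mass_split\<close>).  The same identities hold in a
  weak limit, so that its coefficients are the limit coefficients.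

  Domination.  A path without backtracking of length \<open>j\<close> has at most \<open>D\<close> choices for its first edge and
  at most \<open>D - 1\<close> for each further one (\<open>card_nonbacktracking_paths\<close>).  The total masses are bounded for
  large \<open>n\<close> because they are the masses of the class of a single vertex, which converge.  Dominated
  convergence then gives uniform convergence of the power series on every disc of radius less than
  \<open>1 / (D - 1)\<close> (\<open>uniform_limit_power_series\<close>), and the exponential function preserves it.
\<close>

section \<open>Distances and balls\<close>

lemma edges_subset: "is_graph G \<Longrightarrow> edges G \<subseteq> verts G \<times> verts G"
  by (simp add: is_graph_def)

lemma relpow_in_verts:
  assumes "is_graph G" "x \<in> verts G" "(x, y) \<in> edges G ^^ n"
  shows "y \<in> verts G"
  using assms(3) edges_subset[OF assms(1)] assms(2) by (induction n arbitrary: y) auto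

lemma conn_iff_relpow:
  assumes "is_graph G" "x \<in> verts G"
  shows "(x, y) \<in> conn G \<longleftrightarrow> (\<exists>n. (x, y) \<in> edges G ^^ n)"
  using relpow_in_verts[OF assms] assms(2) by (auto simp: conn_def rtrancl_power)

lemma gdist_le: "(x, y) \<in> edges G ^^ n \<Longrightarrow> gdist G x y \<le> n"
  unfolding gdist_def by (rule Least_le)

lemma relpow_gdist: "(x, y) \<in> conn G \<Longrightarrow> (x, y) \<in> edges G ^^ gdist G x y"
  unfolding gdist_def by (rule LeastI_ex) (auto simp: conn_def rtrancl_power)

lemma gdist_self [simp]: "gdist G x x = 0"
  using gdist_le[where n = 0 and y = x] by simp

lemma conn_self: "x \<in> verts G \<Longrightarrow> (x, x) \<in> conn G"
  by (simp add: conn_def)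

lemma conn_sym: "is_graph G \<Longrightarrow> (x, y) \<in> conn G \<Longrightarrow> (y, x) \<in> conn G"
  unfolding conn_def is_graph_def by (auto intro: symD[OF sym_rtrancl])

lemma conn_trans: "(x, y) \<in> conn G \<Longrightarrow> (y, z) \<in> conn G \<Longrightarrow> (x, z) \<in> conn G"
  by (auto simp: conn_def)

definition ball_verts :: "'v graph \<Rightarrow> nat \<Rightarrow> 'v \<Rightarrow> 'v set" where
  "ball_verts G r x = {y. (x, y) \<in> conn G \<and> gdist G x y \<le> r}"

lemma rooted_ball_eq: "rooted_ball G r x = (induced G (ball_verts G r x), x)"
  by (simp add: rooted_ball_def ball_verts_def)

lemma ball_verts_relpow:
  assumes "is_graph G" "x \<in> verts G"
  shows "ball_verts G r x = (\<Union>k\<le>r. (edges G ^^ k) `` {x})"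
proof -
  have "y \<in> ball_verts G r x \<longleftrightarrow> (\<exists>k\<le>r. (x, y) \<in> edges G ^^ k)" for y
    unfolding ball_verts_def using conn_iff_relpow[OF assms, of y]
    by (auto dest: relpow_gdist gdist_le intro: le_trans)
  then show ?thesis by auto
qed

lemma ball_verts_subset: "ball_verts G r x \<subseteq> verts G"
  by (auto simp: ball_verts_def conn_def)

lemma root_in_ball: "x \<in> verts G \<Longrightarrow> x \<in> ball_verts G r x"
  by (simp add: ball_verts_def conn_self)

lemma finite_card_subset: "A \<subseteq> B \<Longrightarrow> finite B \<Longrightarrow> card B \<le> n \<Longrightarrow> finite A \<and> card A \<le> n"
  using card_mono[of B A] by (auto intro: finite_subset)

lemma card_sphere:
  assumes "is_graph G" "degree_bounded D G" "x \<in> verts G"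
  shows "finite ((edges G ^^ k) `` {x}) \<and> card ((edges G ^^ k) `` {x}) \<le> D ^ k"
proof (induction k)
  case (Suc k)
  let ?S = "(edges G ^^ k) `` {x}"
  have eq: "(edges G ^^ Suc k) `` {x} = (\<Union>y\<in>?S. edges G `` {y})" by auto
  have S: "finite (edges G `` {y}) \<and> card (edges G `` {y}) \<le> D" if "y \<in> ?S" for y
    using that assms relpow_in_verts[OF assms(1,3), of y k] unfolding degree_bounded_def by blast
  have "card (\<Union>y\<in>?S. edges G `` {y}) \<le> (\<Sum>y\<in>?S. card (edges G `` {y}))"
    using Suc by (intro card_UN_le) auto
  also have "\<dots> \<le> (\<Sum>y\<in>?S. D)" by (intro sum_mono) (use S in auto)
  also have "\<dots> \<le> D ^ Suc k" using Suc by simp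
  finally show ?case using S Suc unfolding eq by auto
qed auto

lemma card_ball:
  assumes "is_graph G" "degree_bounded D G" "x \<in> verts G"
  shows "finite (ball_verts G r x)" "card (ball_verts G r x) \<le> (\<Sum>k\<le>r. D ^ k)"
proof -
  note S = card_sphere[OF assms]
  show "finite (ball_verts G r x)" unfolding ball_verts_relpow[OF assms(1,3)] using S by auto
  have "card (ball_verts G r x) \<le> (\<Sum>k\<le>r. card ((edges G ^^ k) `` {x}))"
    unfolding ball_verts_relpow[OF assms(1,3)] by (rule card_UN_le) simp
  also have "\<dots> \<le> (\<Sum>k\<le>r. D ^ k)" using S by (intro sum_mono) auto
  finally show "card (ball_verts G r x) \<le> (\<Sum>k\<le>r. D ^ k)" .
qed

lemma finite_ball:
  assumes "is_graph G" "x \<in> verts G"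
  shows "finite (ball_verts G r x)"
  using assms card_ball(1)[OF assms(1) _ assms(2)] by (auto simp: is_graph_def)

lemma induced_simps [simp]:
  "verts (induced G W) = verts G \<inter> W" "edges (induced G W) = edges G \<inter> W \<times> W"
  by (simp_all add: induced_def)

lemma degree_bounded_induced:
  assumes "degree_bounded D G"
  shows "degree_bounded D (induced G W)"
  unfolding degree_bounded_def
proof
  fix x assume "x \<in> verts (induced G W)"
  then have x: "finite (edges G `` {x})" "card (edges G `` {x}) \<le> D"
    using assms by (auto simp: degree_bounded_def)
  have "edges (induced G W) `` {x} \<subseteq> edges G `` {x}" by auto
  then show "finite (edges (induced G W) `` {x}) \<and> card (edges (induced G W) `` {x}) \<le> D"
    using x card_mono finite_subset le_trans by meson
qed

lemma is_graph_induced: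
  assumes "is_graph G" "x \<in> verts G" "x \<in> W"
  shows "is_graph (induced G W)"
proof -
  obtain D where "D > 0" "degree_bounded D G" using assms by (auto simp: is_graph_def)
  then have "\<exists>D>0. degree_bounded D (induced G W)" using degree_bounded_induced by blast
  moreover have "sym (edges G \<inter> W \<times> W)" using assms by (auto simp: is_graph_def sym_def)
  ultimately show ?thesis using assms by (auto simp: is_graph_def)
qed

text \<open>
  A geodesic from \<open>x\<close> to \<open>y\<close> visits only points at most as far from \<open>x\<close> as \<open>y\<close>, hence it does not
  leave a set \<open>W\<close> that contains all these points.  Balls and components are sets of this kind.
\<close>

lemma gdist_induced:
  assumes G: "is_graph G" "x \<in> verts G" and W: "W \<subseteq> {y. (x, y) \<in> conn G}"
    and closed: "\<And>y z. y \<in> W \<Longrightarrow> (x, z) \<in> conn G \<Longrightarrow> gdist G x z \<le> gdist G x y \<Longrightarrow> z \<in> W"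
    and y: "y \<in> W"
  shows "(x, y) \<in> conn (induced G W)" "gdist (induced G W) x y = gdist G x y"
proof -
  have path: "(x, y) \<in> edges (induced G W) ^^ n" if "y \<in> W" "gdist G x y = n" for y n
    using that
  proof (induction n arbitrary: y)
    case 0
    then show ?case using W relpow_gdist[of x y G] by auto
  next
    case (Suc n)
    then have "(x, y) \<in> edges G ^^ Suc n" using W relpow_gdist[of x y G] by auto
    then obtain z where z: "(x, z) \<in> edges G ^^ n" "(z, y) \<in> edges G" by auto
    have "gdist G x y \<le> Suc (gdist G x z)"
    proof (rule gdist_le)
      have "(x, z) \<in> conn G" using z(1) conn_iff_relpow[OF G] by blast
      then show "(x, y) \<in> edges G ^^ Suc (gdist G x z)" using relpow_gdist z(2) by fastforce
    qed
    then have n: "gdist G x z = n" using gdist_le[OF z(1)] Suc.prems(2) by simp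
    have "z \<in> W" using z(1) n Suc.prems closed[of y z] conn_iff_relpow[OF G] by auto
    then show ?case using Suc.IH[OF _ n] z(2) Suc.prems(1) by auto
  qed
  have "W \<subseteq> verts G" using W by (auto simp: conn_def)
  moreover have "x \<in> W" using closed[OF y conn_self[OF G(2)]] by simp
  ultimately show c: "(x, y) \<in> conn (induced G W)"
    using path[OF y refl] y G(2) unfolding conn_def by (auto simp: rtrancl_power)
  have "(x, y) \<in> edges G ^^ gdist (induced G W) x y"
    using relpow_gdist[OF c] relpowp_mono[of "\<lambda>a b. (a, b) \<in> edges (induced G W)" "\<lambda>a b. (a, b) \<in> edges G"]
    by (simp add: relpowp_relpow_eq del: induced_simps) (simp add: relpowp_relpow_eq)
  then show "gdist (induced G W) x y = gdist G x y"
    using gdist_le[OF path[OF y refl]] gdist_le by (metis antisym)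
qed

lemma gdist_ball:
  assumes "is_graph G" "x \<in> verts G" "y \<in> ball_verts G r x"
  shows "(x, y) \<in> conn (induced G (ball_verts G r x))"
    "gdist (induced G (ball_verts G r x)) x y = gdist G x y"
  by (rule gdist_induced[OF assms(1,2)]; use assms in \<open>auto simp: ball_verts_def\<close>)+

lemma rooted_ball_of_ball:
  assumes "is_graph G" "x \<in> verts G" "r \<le> s"
  shows "rooted_ball (fst (rooted_ball G s x)) r x = rooted_ball G r x"
proof -
  have "ball_verts (induced G (ball_verts G s x)) r x = ball_verts G r x"
  proof (intro set_eqI iffI)
    fix y assume "y \<in> ball_verts (induced G (ball_verts G s x)) r x"
    then have y: "(x, y) \<in> conn (induced G (ball_verts G s x))"
      "gdist (induced G (ball_verts G s x)) x y \<le> r" by (auto simp: ball_verts_def)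
    then have "y \<in> ball_verts G s x" by (auto simp: conn_def)
    with y show "y \<in> ball_verts G r x" using gdist_ball[OF assms(1,2)]
      by (auto simp: ball_verts_def)
  next
    fix y assume y: "y \<in> ball_verts G r x"
    then have "y \<in> ball_verts G s x" using assms(3) by (auto simp: ball_verts_def)
    with y show "y \<in> ball_verts (induced G (ball_verts G s x)) r x"
      using gdist_ball[OF assms(1,2), of y s] by (auto simp: ball_verts_def)
  qed
  moreover have "ball_verts G r x \<subseteq> ball_verts G s x" using assms(3) by (auto simp: ball_verts_def)
  ultimately show ?thesis by (auto simp: rooted_ball_eq induced_def)
qed

lemma radius_rooted_ball:
  assumes "is_graph G" "x \<in> verts G"
  shows "radius (rooted_ball G r x) = Max (gdist G x ` ball_verts G r x)"
proof -
  have "verts (induced G (ball_verts G r x)) = ball_verts G r x"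
    using ball_verts_subset[of G r x] by auto
  moreover have "gdist (induced G (ball_verts G r x)) x ` ball_verts G r x
      = gdist G x ` ball_verts G r x"
    using gdist_ball[OF assms] by (intro image_cong) auto
  ultimately show ?thesis by (simp add: radius_def rooted_ball_eq)
qed

lemma radius_rooted_ball_le:
  assumes "is_graph G" "x \<in> verts G"
  shows "radius (rooted_ball G r x) \<le> r"
proof -
  show ?thesis unfolding radius_rooted_ball[OF assms]
    using finite_ball[OF assms, of r] root_in_ball[OF assms(2), of r] by (subst Max_le_iff) (auto simp: ball_verts_def)
qed

text \<open>
  If some vertex were at distance more than \<open>r\<close> from \<open>x\<close>, then a geodesic to it would meet the
  sphere of radius \<open>r + 1\<close>.  Hence a ball of radius larger than \<open>r\<close> that has no vertex on this
  sphere is already the whole component.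
\<close>

lemma small_ball_is_component:
  assumes G: "is_graph G" "x \<in> verts G" and r: "r < k"
    and small: "\<And>y. y \<in> ball_verts G k x \<Longrightarrow> gdist G x y \<le> r"
    and y: "(x, y) \<in> conn G"
  shows "gdist G x y \<le> r"
proof (rule ccontr)
  assume "\<not> ?thesis"
  then obtain m where m: "gdist G x y = Suc r + m" by (metis add_Suc less_iff_Suc_add not_le)
  then have "(x, y) \<in> edges G ^^ Suc r O edges G ^^ m"
    using relpow_gdist[OF y] by (simp only: m relpow_add)
  then obtain z where z: "(x, z) \<in> edges G ^^ Suc r" "(z, y) \<in> edges G ^^ m" by auto
  have "z \<in> ball_verts G k x"
    using r z(1) unfolding ball_verts_relpow[OF G] by (auto intro!: bexI[of _ "Suc r"])
  then have "gdist G x z \<le> r" "(x, z) \<in> edges G ^^ gdist G x z"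
    using small by (auto simp: ball_verts_def intro: relpow_gdist)
  moreover have "(x, y) \<in> edges G ^^ (gdist G x z + m)"
    using calculation(2) z(2) relpow_add[of "gdist G x z" m "edges G"] by auto
  ultimately show False using gdist_le m by fastforce
qed

lemma rooted_component_eq_ball:
  assumes "\<And>y. (x, y) \<in> conn G \<Longrightarrow> gdist G x y \<le> k"
  shows "rooted_component G x = rooted_ball G k x"
proof -
  have "{y. (x, y) \<in> conn G} = ball_verts G k x" using assms by (auto simp: ball_verts_def)
  then show ?thesis by (simp add: rooted_component_def component_def rooted_ball_eq)
qed

lemma gdist_component:
  assumes "is_graph G" "(x, y) \<in> conn G"
  shows "gdist (component G x) x y = gdist G x y"
proof -
  have "x \<in> verts G" using assms(2) by (auto simp: conn_def)
  then show ?thesis using gdist_induced(2)[OF assms(1) _ subset_refl, of x y] assms(2)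
    by (auto simp: component_def)
qed

text \<open>
  Finiteness of the component, a global condition, is thus visible in a single ball of any radius
  \<open>k\<close> larger than \<open>r\<close>.
\<close>

lemma verts_fin_iff_radius_ball:
  assumes G: "is_graph G" "x \<in> verts G" and r: "r < k"
  shows "x \<in> verts_fin G r \<longleftrightarrow> radius (rooted_ball G k x) = r"
proof -
  have fin: "finite (ball_verts G k x)" by (rule finite_ball[OF G])
  have vb: "verts (fst (rooted_ball G k x)) = ball_verts G k x"
    using ball_verts_subset[of G k x] by (auto simp: rooted_ball_eq)
  have vc: "verts (component G x) = {y. (x, y) \<in> conn G}"
    by (auto simp: component_def conn_def)
  show ?thesis
  proof
    assume "x \<in> verts_fin G r"
    then have f: "finite {y. (x, y) \<in> conn G}" and rad: "radius (rooted_component G x) = r"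
      by (auto simp: verts_fin_def vc)
    have "gdist G x y \<le> k" if "(x, y) \<in> conn G" for y
    proof -
      have "gdist (component G x) x y \<le> r"
        using f that rad by (auto simp: radius_def rooted_component_def vc intro!: Max_ge)
      then show ?thesis using gdist_component[OF G(1) that] r by simp
    qed
    then show "radius (rooted_ball G k x) = r" using rooted_component_eq_ball rad by metis
  next
    assume rad: "radius (rooted_ball G k x) = r"
    then have "gdist G x y \<le> r" if "y \<in> ball_verts G k x" for y
      using that fin unfolding radius_rooted_ball[OF G] by auto
    then have "gdist G x y \<le> r" if "(x, y) \<in> conn G" for y
      using small_ball_is_component[OF G r] that by blast
    then have "gdist G x y \<le> k" if "(x, y) \<in> conn G" for y
      using that r by (meson le_trans less_imp_le)
    then have c: "rooted_component G x = rooted_ball G k x" by (rule rooted_component_eq_ball)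
    moreover have "verts (component G x) = ball_verts G k x"
      using vb c by (metis fst_conv rooted_component_def)
    ultimately show "x \<in> verts_fin G r" using G fin rad by (auto simp: verts_fin_def)
  qed
qed

lemma ball_stable_of_radius_less:
  assumes G: "is_graph G" "x \<in> verts G" and k: "radius (rooted_ball G k x) = r" "r < k"
    and s: "r \<le> s"
  shows "rooted_ball G s x = rooted_ball G k x"
proof -
  have fin: "finite (ball_verts G k x)" by (rule finite_ball[OF G])
  then have "gdist G x y \<le> r" if "y \<in> ball_verts G k x" for y
    using that k(1) unfolding radius_rooted_ball[OF G] by auto
  then have "gdist G x y \<le> r" if "(x, y) \<in> conn G" for y
    using small_ball_is_component[OF G k(2)] that by blast
  then have "ball_verts G s x = ball_verts G k x" using s k(2) by (fastforce simp: ball_verts_def)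
  then show ?thesis by (simp add: rooted_ball_eq)
qed

section \<open>Isomorphisms\<close>

lemma graph_isoD:
  assumes "graph_iso f G H"
  shows "bij_betw f (verts G) (verts H)"
    "x \<in> verts G \<Longrightarrow> y \<in> verts G \<Longrightarrow> (x, y) \<in> edges G \<longleftrightarrow> (f x, f y) \<in> edges H"
    "x \<in> verts G \<Longrightarrow> f x \<in> verts H"
  using assms by (auto simp: graph_iso_def bij_betw_def)

lemma graph_iso_inv:
  assumes "graph_iso f G H"
  shows "graph_iso (inv_into (verts G) f) H G"
proof -
  note f = graph_isoD[OF assms]
  have b: "bij_betw (inv_into (verts G) f) (verts H) (verts G)" by (rule bij_betw_inv_into[OF f(1)])
  have "(x, y) \<in> edges H \<longleftrightarrow> (inv_into (verts G) f x, inv_into (verts G) f y) \<in> edges G"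
    if "x \<in> verts H" "y \<in> verts H" for x y
    using f(2)[of "inv_into (verts G) f x" "inv_into (verts G) f y"] that b
      bij_betw_inv_into_right[OF f(1)] by (auto simp: bij_betw_def)
  then show ?thesis using b by (simp add: graph_iso_def)
qed

lemma graph_iso_comp:
  assumes "graph_iso f G H" "graph_iso g H K"
  shows "graph_iso (g \<circ> f) G K"
  using graph_isoD[OF assms(1)] graph_isoD[OF assms(2)]
  by (auto simp: graph_iso_def intro: bij_betw_trans)

lemma rooted_iso_refl: "rooted_iso H H"
  by (auto simp: rooted_iso_def graph_iso_def split: prod.split intro!: exI[of _ id])

lemma rooted_iso_sym:
  assumes "is_rooted H" "rooted_iso H K"
  shows "rooted_iso K H"
proof -
  obtain f where f: "graph_iso f (fst H) (fst K)" "f (snd H) = snd K"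
    using assms by (auto simp: rooted_iso_def split: prod.splits)
  have "inv_into (verts (fst H)) f (snd K) = snd H"
    using bij_betw_inv_into_left[OF graph_isoD(1)[OF f(1)], of "snd H"] assms(1) f(2)
    by (auto simp: is_rooted_def split: prod.splits)
  then show ?thesis using graph_iso_inv[OF f(1)] by (auto simp: rooted_iso_def split: prod.splits)
qed

lemma rooted_iso_trans: "rooted_iso H K \<Longrightarrow> rooted_iso K L \<Longrightarrow> rooted_iso H L"
  by (fastforce simp: rooted_iso_def split: prod.splits intro: graph_iso_comp)

lemma iso_class_cong:
  assumes "is_rooted H" "rooted_iso H K"
  shows "iso_class H = iso_class K"
  using rooted_iso_trans[OF _ assms(2)] rooted_iso_trans[OF _ rooted_iso_sym[OF assms]]
  unfolding iso_class_def by blast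

lemma relpow_graph_iso:
  assumes "graph_iso f G H" "edges G \<subseteq> verts G \<times> verts G" "x \<in> verts G" "(x, y) \<in> edges G ^^ n"
  shows "(f x, f y) \<in> edges H ^^ n"
  using assms(4)
proof (induction n arbitrary: y)
  case (Suc n)
  then obtain z where z: "(x, z) \<in> edges G ^^ n" "(z, y) \<in> edges G" by auto
  then have "(f z, f y) \<in> edges H" using assms(2) graph_isoD(2)[OF assms(1)] by blast
  then show ?case using Suc.IH[OF z(1)] by auto
qed auto

lemma relpow_graph_iso_iff:
  assumes "graph_iso f G H" "is_graph G" "is_graph H" "x \<in> verts G" "y \<in> verts G"
  shows "(f x, f y) \<in> edges H ^^ n \<longleftrightarrow> (x, y) \<in> edges G ^^ n"
proof
  let ?g = "inv_into (verts G) f"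
  assume "(f x, f y) \<in> edges H ^^ n"
  then have "(?g (f x), ?g (f y)) \<in> edges G ^^ n"
    using assms graph_isoD(3)[OF assms(1)]
    by (intro relpow_graph_iso[OF graph_iso_inv[OF assms(1)]]) (auto dest: edges_subset)
  then show "(x, y) \<in> edges G ^^ n"
    using bij_betw_inv_into_left[OF graph_isoD(1)[OF assms(1)]] assms by simp
qed (use relpow_graph_iso assms edges_subset in metis)

lemma gdist_graph_iso:
  assumes "graph_iso f G H" "is_graph G" "is_graph H" "x \<in> verts G" "y \<in> verts G"
  shows "gdist H (f x) (f y) = gdist G x y"
  unfolding gdist_def using relpow_graph_iso_iff[OF assms] by simp

lemma radius_rooted_iso:
  assumes "is_rooted H" "is_rooted K" "rooted_iso H K"
  shows "radius H = radius K"
proof -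
  obtain A x B y where HK: "H = (A, x)" "K = (B, y)" by (cases H, cases K)
  then obtain f where f: "graph_iso f A B" "f x = y" using assms(3) by (auto simp: rooted_iso_def)
  have g: "is_graph A" "is_graph B" "x \<in> verts A" using assms HK by (auto simp: is_rooted_def)
  have "verts B = f ` verts A" using graph_isoD(1)[OF f(1)] by (auto simp: bij_betw_def)
  then have "gdist B y ` verts B = gdist A x ` verts A"
    using gdist_graph_iso[OF f(1) g] f(2) by (force simp: image_image)
  then show ?thesis by (simp add: radius_def HK)
qed

lemma rooted_ball_rooted_iso:
  assumes "is_rooted (A, x)" "is_rooted (B, y)" "rooted_iso (A, x) (B, y)"
  shows "rooted_iso (rooted_ball A r x) (rooted_ball B r y)"
proof -
  obtain f where f: "graph_iso f A B" "f x = y" using assms(3) by (auto simp: rooted_iso_def)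
  have g: "is_graph A" "is_graph B" "x \<in> verts A" "y \<in> verts B"
    using assms by (auto simp: is_rooted_def)
  note bij = graph_isoD(1)[OF f(1)]
  have mem: "f z \<in> ball_verts B r y \<longleftrightarrow> z \<in> ball_verts A r x" if "z \<in> verts A" for z
    using relpow_graph_iso_iff[OF f(1) g(1-3) that]
    unfolding ball_verts_relpow[OF g(1,3)] ball_verts_relpow[OF g(2,4)] by (auto simp: f(2)[symmetric])
  have "f ` (verts A \<inter> ball_verts A r x) = verts B \<inter> ball_verts B r y"
  proof -
    have "verts B = f ` verts A" using bij by (auto simp: bij_betw_def)
    then show ?thesis using mem by auto
  qed
  then have "bij_betw f (verts A \<inter> ball_verts A r x) (verts B \<inter> ball_verts B r y)"
    using bij inj_on_subset by (auto simp: bij_betw_def intro: inj_on_subset)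
  then have "graph_iso f (induced A (ball_verts A r x)) (induced B (ball_verts B r y))"
    using mem graph_isoD(2)[OF f(1)] by (auto simp: graph_iso_def)
  then show ?thesis using f(2) by (auto simp: rooted_iso_def rooted_ball_eq)
qed

lemma is_rooted_ball:
  assumes "is_graph G" "x \<in> verts G"
  shows "is_rooted (rooted_ball G r x)"
  using is_graph_induced[OF assms root_in_ball[OF assms(2)]] root_in_ball[OF assms(2)] assms(2)
  by (simp add: is_rooted_def rooted_ball_eq)

text \<open>
  Classes consist of rooted graphs on natural numbers, so such a copy is needed for the class of a
  finite rooted graph to be nonempty.
\<close>

lemma nat_copy:
  assumes "is_rooted (A, x)" "finite (verts A)"
  obtains f B where "is_rooted (B, f x)" "graph_iso f A B" "verts B = {..<card (verts A)}"
proof -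
  obtain f where f: "bij_betw f (verts A) {..<card (verts A)}"
    using ex_bij_betw_finite_nat[OF assms(2)] by (auto simp: atLeast0LessThan)
  let ?B = "\<lparr>verts = {..<card (verts A)}, edges = map_prod f f ` edges A\<rparr>"
  have A: "is_graph A" "x \<in> verts A" using assms(1) by (auto simp: is_rooted_def)
  have inj: "inj_on f (verts A)" and im: "f ` verts A = {..<card (verts A)}"
    using f by (auto simp: bij_betw_def)
  have E: "edges A \<subseteq> verts A \<times> verts A" by (rule edges_subset[OF A(1)])
  have edge: "(f a, f b) \<in> edges ?B \<longleftrightarrow> (a, b) \<in> edges A" if "a \<in> verts A" "b \<in> verts A" for a b
  proof
    assume "(f a, f b) \<in> edges ?B"
    then obtain c d where cd: "(c, d) \<in> edges A" "f a = f c" "f b = f d" by auto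
    then have "c \<in> verts A" "d \<in> verts A" using E by auto
    then show "(a, b) \<in> edges A" using cd inj_onD[OF inj] that by metis
  qed auto
  have iso: "graph_iso f A ?B" using f edge by (simp add: graph_iso_def)
  have EB: "edges ?B \<subseteq> verts ?B \<times> verts ?B" using E im by auto
  \<comment> \<open>The successor makes the degree bound positive, as the notion of a graph demands.\<close>
  have "degree_bounded (Suc (card (verts A))) ?B"
    unfolding degree_bounded_def
  proof
    fix a assume "a \<in> verts ?B"
    have "edges ?B `` {a} \<subseteq> {..<card (verts A)}" using EB by auto
    then show "finite (edges ?B `` {a}) \<and> card (edges ?B `` {a}) \<le> Suc (card (verts A))"
      using card_mono[of "{..<card (verts A)}" "edges ?B `` {a}"] by (auto intro: finite_subset)
  qed
  moreover have "sym (edges ?B)" using A by (force simp: is_graph_def sym_def)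
  moreover have "(a, a) \<notin> edges ?B" for a
    using A E inj by (auto simp: is_graph_def inj_on_def)
  moreover have "f x \<in> verts ?B" using im A by auto
  ultimately have "is_rooted (?B, f x)" using EB unfolding is_rooted_def is_graph_def by blast
  then show ?thesis using iso by (intro that[of ?B f]) auto
qed

section \<open>Classes\<close>

lemma degree_bounded_graph_iso:
  assumes "graph_iso f G H" "is_graph G" "is_graph H" "degree_bounded D G"
  shows "degree_bounded D H"
  unfolding degree_bounded_def
proof
  fix y assume y: "y \<in> verts H"
  then obtain x where x: "x \<in> verts G" "y = f x"
    using graph_isoD(1)[OF assms(1)] by (auto simp: bij_betw_def)
  have "edges H `` {y} \<subseteq> f ` (edges G `` {x})"
  proof
    fix b assume b: "b \<in> edges H `` {y}"
    then have "b \<in> verts H" using assms(3) by (auto simp: is_graph_def)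
    then obtain a where a: "a \<in> verts G" "b = f a"
      using graph_isoD(1)[OF assms(1)] by (auto simp: bij_betw_def)
    then show "b \<in> f ` (edges G `` {x})" using graph_isoD(2)[OF assms(1) x(1) a(1)] b x(2) by auto
  qed
  moreover have fin: "finite (edges G `` {x})" and "card (edges G `` {x}) \<le> D"
    using assms(4) x(1) by (auto simp: degree_bounded_def)
  ultimately show "finite (edges H `` {y}) \<and> card (edges H `` {y}) \<le> D"
    using card_mono[of "f ` (edges G `` {x})" "edges H `` {y}"] card_image_le[OF fin, of f]
    by (auto intro: finite_subset)
qed

lemma connected_graph_iso:
  assumes "graph_iso f G H" "is_graph G" "is_graph H" "connected_graph G"
  shows "connected_graph H"
  unfolding connected_graph_def
proof (intro ballI)
  fix a b assume ab: "a \<in> verts H" "b \<in> verts H"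
  moreover have "verts H = f ` verts G"
    using graph_isoD(1)[OF assms(1)] by (simp add: bij_betw_def)
  ultimately obtain x y where xy: "x \<in> verts G" "a = f x" "y \<in> verts G" "b = f y" by auto
  have "(x, y) \<in> conn G" using assms(4) xy by (simp add: connected_graph_def)
  then obtain n where "(x, y) \<in> edges G ^^ n" using conn_iff_relpow[OF assms(2) xy(1)] by auto
  then show "(a, b) \<in> conn H"
    using relpow_graph_iso_iff[OF assms(1-3) xy(1,3)] conn_iff_relpow[OF assms(3) ab(1)] xy by auto
qed

lemma iso_class_members:
  assumes "is_rooted H" "K \<in> iso_class H"
  shows "is_rooted K" "rooted_iso K H" "radius K = radius H" "iso_class K = iso_class H"
proof -
  show K: "is_rooted K" "rooted_iso K H" using assms by (auto simp: iso_class_def)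
  show "radius K = radius H" by (rule radius_rooted_iso[OF K(1) assms(1) K(2)])
  show "iso_class K = iso_class H" by (rule iso_class_cong[OF K])
qed

lemma ball_class_representative:
  assumes "is_graph G" "x \<in> verts G"
  shows "(SOME H. H \<in> ball_class G r x) \<in> ball_class G r x"
proof -
  let ?B = "induced G (ball_verts G r x)"
  have B: "is_rooted (?B, x)" using is_rooted_ball[OF assms, of r] by (simp add: rooted_ball_eq)
  have "finite (verts ?B)" using finite_ball[OF assms] by auto
  then obtain f and K :: "nat graph" where K: "is_rooted (K, f x)" "graph_iso f ?B K"
    using nat_copy[OF B] by metis
  then have "rooted_iso (K, f x) (?B, x)"
    by (intro rooted_iso_sym[OF B]) (auto simp: rooted_iso_def)
  then have "(K, f x) \<in> ball_class G r x"
    using K(1) by (simp add: ball_class_def iso_class_def rooted_ball_eq)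
  then show ?thesis by (rule someI)
qed

lemma class_radius_ball_class:
  assumes "is_graph G" "x \<in> verts G"
  shows "class_radius (ball_class G r x) = radius (rooted_ball G r x)"
  using iso_class_members(3)[OF is_rooted_ball[OF assms]] ball_class_representative[OF assms, of r]
  by (simp add: class_radius_def ball_class_def)

lemma class_radius_eq:
  assumes "\<alpha> \<in> classes_radius D r"
  shows "class_radius \<alpha> = r"
proof -
  obtain H :: "nat rooted" where H: "\<alpha> = iso_class H" "is_rooted H" "radius H = r"
    using assms by (auto simp: classes_radius_def)
  have "H \<in> \<alpha>" using H rooted_iso_refl by (simp add: iso_class_def)
  then have "(SOME K. K \<in> \<alpha>) \<in> \<alpha>" by (rule someI)
  then show ?thesis using H iso_class_members(3)[of H] by (simp add: class_radius_def)
qed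

lemma ball_class_in_classes:
  assumes "is_graph G" "x \<in> verts G" "degree_bounded D G"
  shows "ball_class G k x \<in> classes_radius D (radius (rooted_ball G k x))"
proof -
  let ?B = "induced G (ball_verts G k x)"
  have B: "is_graph ?B" "x \<in> verts ?B" "is_rooted (?B, x)"
    using is_rooted_ball[OF assms(1,2), of k] by (auto simp: rooted_ball_eq is_rooted_def)
  have fin: "finite (verts ?B)" using card_ball(1)[OF assms(1,3,2)] by auto
  have "connected_graph ?B"
    unfolding connected_graph_def
  proof (intro ballI)
    fix y z assume "y \<in> verts ?B" "z \<in> verts ?B"
    then have "(x, y) \<in> conn ?B" "(x, z) \<in> conn ?B" using gdist_ball(1)[OF assms(1,2)] by auto
    then show "(y, z) \<in> conn ?B" using conn_sym[OF B(1)] conn_trans by metis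
  qed
  moreover obtain f K where K: "is_rooted (K, f x)" "graph_iso f ?B K"
      "verts K = {..<card (verts ?B)}"
    using nat_copy[OF B(3) fin] .
  moreover have "is_graph K" using K(1) by (simp add: is_rooted_def)
  ultimately have "connected_graph K" "degree_bounded D K"
    using connected_graph_iso B(1) degree_bounded_graph_iso degree_bounded_induced[OF assms(3)]
    by blast+
  moreover have iso: "rooted_iso (?B, x) (K, f x)" using K(2) by (auto simp: rooted_iso_def)
  ultimately show ?thesis
    using K iso_class_cong[OF B(3) iso] radius_rooted_iso[OF B(3) K(1) iso]
    unfolding classes_radius_def ball_class_def rooted_ball_eq
    by (auto intro!: exI[of _ K] exI[of _ "f x"])
qed

text \<open>
  A rooted graph of radius \<open>r\<close> and degrees at most \<open>D\<close> has at most \<open>1 + D + \<dots> + D\<^sup>r\<close> vertices, so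
  up to isomorphism it is a graph on an initial segment of the natural numbers of bounded length.
\<close>

lemma finite_classes_radius: "finite (classes_radius D r)"
proof -
  define N where "N = (\<Sum>k\<le>r. D ^ k)"
  let ?R = "(\<lambda>(W, E, a). iso_class (\<lparr>verts = W, edges = E\<rparr>, a)) `
     (Pow {..<N} \<times> Pow ({..<N} \<times> {..<N}) \<times> {..<N}) :: rclass set"
  have "classes_radius D r \<subseteq> ?R"
  proof
    fix \<alpha> assume "\<alpha> \<in> classes_radius D r"
    then obtain A :: "nat graph" and x where A: "\<alpha> = iso_class (A, x)" "is_rooted (A, x)" "finite (verts A)"
        "connected_graph A" "degree_bounded D A" "radius (A, x) = r"
      unfolding classes_radius_def by force
    then have g: "is_graph A" "x \<in> verts A" by (auto simp: is_rooted_def)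
    have "verts A \<subseteq> ball_verts A r x"
      using A g unfolding ball_verts_def connected_graph_def radius_def by (auto intro!: Max_ge)
    then have card: "card (verts A) \<le> N"
      using card_ball[OF g(1) A(5) g(2), of r] card_mono N_def le_trans by metis
    obtain f B where B: "is_rooted (B, f x)" "graph_iso f A B" "verts B = {..<card (verts A)}"
      using nat_copy[OF A(2,3)] .
    have "\<alpha> = iso_class (B, f x)"
      unfolding A(1) using B by (intro iso_class_cong[OF A(2)]) (auto simp: rooted_iso_def)
    moreover have "\<lparr>verts = verts B, edges = edges B\<rparr> = B" by simp
    ultimately have "\<alpha> = (\<lambda>(W, E, a). iso_class (\<lparr>verts = W, edges = E\<rparr>, a)) (verts B, edges B, f x)"
      by (simp only: split)
    moreover have "edges B \<subseteq> verts B \<times> verts B" "f x \<in> verts B"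
      using B(1) by (auto simp: is_rooted_def is_graph_def)
    then have "(verts B, edges B, f x) \<in> Pow {..<N} \<times> Pow ({..<N} \<times> {..<N}) \<times> {..<N}"
      using B(3) card by auto
    ultimately show "\<alpha> \<in> ?R" by blast
  qed
  then show ?thesis by (rule finite_subset) simp
qed

text \<open>
  A ball of radius \<open>k\<close> whose class has radius \<open>r < k\<close> has stopped growing at \<open>r\<close>, so it is the
  component.  This describes the vertices with finite component by the class of one ball alone; the
  measurability of their set follows, since ball classes are measurable functions.
\<close>

lemma verts_fin_inter_class:
  assumes G: "is_graph G" and "\<alpha> \<in> classes_radius D r" "r < k"
  shows "verts_fin G (class_radius \<alpha>) \<inter> verts_class G \<alpha> = {x \<in> verts G. ball_class G k x = \<alpha>}"
proof -
  have r: "class_radius \<alpha> = r" by (rule class_radius_eq[OF assms(2)])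
  have "x \<in> verts_fin G r \<and> ball_class G r x = \<alpha> \<longleftrightarrow> ball_class G k x = \<alpha>" if x: "x \<in> verts G" for x
  proof (cases "radius (rooted_ball G k x) = r")
    case True
    then show ?thesis
      using verts_fin_iff_radius_ball[OF G x assms(3)]
        ball_stable_of_radius_less[OF G x True assms(3) order_refl] by (simp add: ball_class_def)
  next
    case False
    then show ?thesis
      using verts_fin_iff_radius_ball[OF G x assms(3)] class_radius_ball_class[OF G x, of k] r by auto
  qed
  then show ?thesis by (auto simp: verts_class_def r verts_fin_def)
qed

definition truncate_class :: "nat \<Rightarrow> rclass \<Rightarrow> rclass" where
  "truncate_class r \<beta> = (case (SOME H. H \<in> \<beta>) of (H, y) \<Rightarrow> ball_class H r y)"

text \<open>
  An isomorphism of rooted graphs preserves the distance from the root, so the class of a ball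
  determines the classes of all smaller balls.
\<close>

lemma truncate_ball_class:
  assumes "is_graph G" "x \<in> verts G" "r \<le> s"
  shows "truncate_class r (ball_class G s x) = ball_class G r x"
proof -
  obtain A y where A: "(SOME H. H \<in> ball_class G s x) = (A, y)" by fastforce
  then have "(A, y) \<in> iso_class (rooted_ball G s x)"
    using ball_class_representative[OF assms(1,2), of s] by (simp add: ball_class_def)
  then have iso: "is_rooted (A, y)" "rooted_iso (A, y) (rooted_ball G s x)"
    using iso_class_members[OF is_rooted_ball[OF assms(1,2)]] by auto
  have x: "rooted_ball G s x = (fst (rooted_ball G s x), x)" by (simp add: rooted_ball_eq)
  have "rooted_iso (rooted_ball A r y) (rooted_ball (fst (rooted_ball G s x)) r x)"
    using iso x is_rooted_ball[OF assms(1,2), of s] by (intro rooted_ball_rooted_iso) metis+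
  then have "iso_class (rooted_ball A r y) = iso_class (rooted_ball G r x)"
    using iso_class_cong[OF is_rooted_ball[of A y r]] iso(1) rooted_ball_of_ball[OF assms]
    by (simp add: is_rooted_def)
  then show ?thesis unfolding truncate_class_def A by (simp add: ball_class_def)
qed

section \<open>Reduced closed paths\<close>

lemma path_relpow:
  assumes "is_path G es" "i < length es"
  shows "(fst (hd es), fst (es ! i)) \<in> edges G ^^ i" "(fst (hd es), snd (es ! i)) \<in> edges G ^^ Suc i"
proof -
  have e: "es ! i \<in> edges G" if "i < length es" for i
    using assms(1) that nth_mem by (auto simp: is_path_def)
  have *: "(fst (hd es), fst (es ! i)) \<in> edges G ^^ i" if "i < length es" for i
    using that
  proof (induction i)
    case 0
    then show ?case by (simp add: hd_conv_nth)
  next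
    case (Suc i)
    then have "(fst (es ! i), fst (es ! Suc i)) \<in> edges G"
      using e[of i] assms(1) by (metis Suc_lessD is_path_def prod.collapse)
    then show ?case using Suc by auto
  qed
  show "(fst (hd es), fst (es ! i)) \<in> edges G ^^ i" by (rule *[OF assms(2)])
  then show "(fst (hd es), snd (es ! i)) \<in> edges G ^^ Suc i"
    using e[OF assms(2)] by (cases "es ! i") auto
qed

definition nonbacktracking_paths :: "'v graph \<Rightarrow> nat \<Rightarrow> 'v \<Rightarrow> ('v \<times> 'v) list set" where
  "nonbacktracking_paths G n x = {es. is_path G es \<and> length es = n \<and> fst (hd es) = x \<and>
     (\<forall>i. Suc i < length es \<longrightarrow> es ! Suc i \<noteq> prod.swap (es ! i))}"

text \<open>
  The first edge can be chosen in at most \<open>D\<close> ways; each further one in at most \<open>D - 1\<close> ways, since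
  the reversal of its predecessor is excluded.
\<close>

lemma card_nonbacktracking_paths:
  assumes G: "is_graph G" "degree_bounded D G" "x \<in> verts G"
  shows "finite (nonbacktracking_paths G (Suc n) x) \<and>
    card (nonbacktracking_paths G (Suc n) x) \<le> D * (D - 1) ^ n"
proof (induction n)
  case 0
  have "nonbacktracking_paths G (Suc 0) x \<subseteq> (\<lambda>y. [(x, y)]) ` (edges G `` {x})"
    by (auto simp: nonbacktracking_paths_def is_path_def length_Suc_conv)
  moreover have "finite (edges G `` {x})" "card (edges G `` {x}) \<le> D"
    using G by (auto simp: degree_bounded_def)
  moreover from this have "card ((\<lambda>y. [(x, y)]) ` (edges G `` {x})) \<le> D"
    using card_image_le le_trans by blast
  ultimately show ?case
    using finite_card_subset[of "nonbacktracking_paths G (Suc 0) x" "(\<lambda>y. [(x, y)]) ` (edges G `` {x})" D]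
    by simp
next
  case (Suc n)
  let ?P = "nonbacktracking_paths G (Suc n) x"
  define next_edges where "next_edges es = {e \<in> edges G. fst e = snd (last es) \<and> e \<noteq> prod.swap (last es)}"
    for es :: "('a \<times> 'a) list"
  have ext: "nonbacktracking_paths G (Suc (Suc n)) x \<subseteq> (\<Union>es\<in>?P. (\<lambda>e. es @ [e]) ` next_edges es)"
  proof
    fix fs assume fs: "fs \<in> nonbacktracking_paths G (Suc (Suc n)) x"
    then have len: "length fs = Suc (Suc n)" by (simp add: nonbacktracking_paths_def)
    then obtain es e where es: "fs = es @ [e]" "length es = Suc n"
      by (cases fs rule: rev_cases) auto
    have nth: "fs ! i = es ! i" if "i < Suc n" for i using es that by (simp add: nth_append)
    have ends: "fs ! n = last es" "fs ! Suc n = e"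
      using es nth[of n] last_conv_nth[of es] by (cases "es = []"; simp add: nth_append)+
    have "snd (es ! i) = fst (es ! Suc i) \<and> es ! Suc i \<noteq> prod.swap (es ! i)" if "Suc i < Suc n" for i
      using fs len that nth[of i] nth[of "Suc i"]
      by (auto simp: nonbacktracking_paths_def is_path_def dest: spec[of _ i])
    moreover have "hd es = hd fs" "set es \<subseteq> set fs" using es by (auto simp: hd_append)
    ultimately have "es \<in> ?P"
      using fs es(2) by (auto simp: nonbacktracking_paths_def is_path_def)
    moreover have "e \<in> next_edges es"
      using fs len ends es(1) unfolding nonbacktracking_paths_def is_path_def next_edges_def
      by (auto dest: spec[of _ n])
    ultimately show "fs \<in> (\<Union>es\<in>?P. (\<lambda>e. es @ [e]) ` next_edges es)" using es(1) by auto
  qed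
  have next_card: "finite (next_edges es) \<and> card (next_edges es) \<le> D - 1" if "es \<in> ?P" for es
  proof -
    let ?y = "snd (last es)"
    have es: "is_path G es" "es \<noteq> []" using that by (auto simp: nonbacktracking_paths_def)
    then have last: "last es \<in> edges G" by (auto simp: is_path_def)
    then have y: "?y \<in> verts G" and swap: "prod.swap (last es) \<in> edges G"
      using G(1) by (cases "last es"; auto simp: is_graph_def sym_def)+
    have "next_edges es \<subseteq> Pair ?y ` (edges G `` {?y} - {fst (last es)})"
      by (auto simp: next_edges_def image_iff prod.swap_def)
    moreover have "finite (edges G `` {?y})" "card (edges G `` {?y}) \<le> D"
      using G(2) y by (auto simp: degree_bounded_def)
    moreover have "card (Pair ?y ` (edges G `` {?y} - {fst (last es)}))
        = card (edges G `` {?y} - {fst (last es)})" by (intro card_image) (auto simp: inj_on_def)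
    moreover have "card (edges G `` {?y} - {fst (last es)}) = card (edges G `` {?y}) - 1"
      using swap by (intro card_Diff_singleton) (simp add: prod.swap_def)
    ultimately show ?thesis
      using finite_card_subset[of "next_edges es" "Pair ?y ` (edges G `` {?y} - {fst (last es)})" "D - 1"]
      by simp
  qed
  have fin: "finite (\<Union>es\<in>?P. (\<lambda>e. es @ [e]) ` next_edges es)" using Suc next_card by auto
  have "card (\<Union>es\<in>?P. (\<lambda>e. es @ [e]) ` next_edges es) \<le> (\<Sum>es\<in>?P. card ((\<lambda>e. es @ [e]) ` next_edges es))"
    using Suc by (intro card_UN_le) auto
  also have "\<dots> \<le> (\<Sum>es\<in>?P. D - 1)"
    using next_card card_image_le le_trans by (intro sum_mono) blast
  also have "\<dots> \<le> D * (D - 1) ^ Suc n" using Suc by simp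
  finally show ?case by (rule finite_card_subset[OF ext fin])
qed

lemma num_rcp_le:
  assumes "is_graph G" "degree_bounded D G" "x \<in> verts G"
  shows "num_rcp G (Suc n) x \<le> D * (D - 1) ^ n"
    "finite {es. reduced_closed_path G es \<and> length es = Suc n \<and> fst (hd es) = x}"
proof -
  have sub: "{es. reduced_closed_path G es \<and> length es = Suc n \<and> fst (hd es) = x}
      \<subseteq> nonbacktracking_paths G (Suc n) x"
    by (auto simp: nonbacktracking_paths_def reduced_closed_path_def)
  then show "num_rcp G (Suc n) x \<le> D * (D - 1) ^ n"
    "finite {es. reduced_closed_path G es \<and> length es = Suc n \<and> fst (hd es) = x}"
    unfolding num_rcp_def using card_nonbacktracking_paths[OF assms, of n]
      finite_card_subset[OF sub, of "D * (D - 1) ^ n"] by simp_all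
qed

lemma num_rcp_0 [simp]: "num_rcp G 0 x = 0"
  by (auto simp: num_rcp_def reduced_closed_path_def)

text \<open>A path of length \<open>j\<close> from \<open>x\<close> stays in the ball of radius \<open>j\<close>.\<close>

lemma num_rcp_ball:
  assumes "is_graph G" "x \<in> verts G"
  shows "num_rcp (fst (rooted_ball G j x)) j x = num_rcp G j x"
proof -
  have "is_path (induced G (ball_verts G j x)) es \<longleftrightarrow> is_path G es"
    if es: "length es = j" "fst (hd es) = x" for es
  proof
    assume p: "is_path G es"
    have "es ! i \<in> ball_verts G j x \<times> ball_verts G j x" if "i < length es" for i
    proof -
      have "(x, fst (es ! i)) \<in> edges G ^^ i" "(x, snd (es ! i)) \<in> edges G ^^ Suc i"
        using path_relpow[OF p that] es by auto
      then have "fst (es ! i) \<in> ball_verts G j x" "snd (es ! i) \<in> ball_verts G j x"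
        using that es unfolding ball_verts_relpow[OF assms]
        by (blast intro: less_imp_le Suc_leI)+
      then show ?thesis by (simp add: mem_Times_iff)
    qed
    then have "set es \<subseteq> ball_verts G j x \<times> ball_verts G j x" by (metis in_set_conv_nth subsetI)
    then show "is_path (induced G (ball_verts G j x)) es" using p by (auto simp: is_path_def)
  qed (auto simp: is_path_def)
  then have "{es. reduced_closed_path (induced G (ball_verts G j x)) es \<and> length es = j \<and> fst (hd es) = x}
      = {es. reduced_closed_path G es \<and> length es = j \<and> fst (hd es) = x}"
    by (auto simp: reduced_closed_path_def)
  then show ?thesis by (simp add: num_rcp_def rooted_ball_eq)
qed

text \<open>
  An isomorphism maps reduced closed paths injectively to reduced closed paths.  Together with the
  inverse isomorphism this inequality yields equality.
\<close>

lemma num_rcp_graph_iso_le: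
  assumes f: "graph_iso f G H" and g: "is_graph G" "is_graph H" "x \<in> verts G"
  shows "num_rcp G j x \<le> num_rcp H j (f x)"
proof (cases j)
  case (Suc n)
  let ?S = "{es. reduced_closed_path G es \<and> length es = j \<and> fst (hd es) = x}"
  let ?T = "{es. reduced_closed_path H es \<and> length es = j \<and> fst (hd es) = f x}"
  let ?F = "map_prod f f"
  have E: "edges G \<subseteq> verts G \<times> verts G" by (rule edges_subset[OF g(1)])
  have inj: "inj_on f (verts G)" using graph_isoD(1)[OF f] by (simp add: bij_betw_def)
  have swap: "?F e = prod.swap (?F e') \<longleftrightarrow> e = prod.swap e'" if "e \<in> edges G" "e' \<in> edges G" for e e'
    using that E inj by (cases e; cases e') (auto simp: inj_on_def)
  have "map ?F es \<in> ?T" if es: "es \<in> ?S" for es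
  proof -
    have ne: "es \<noteq> []" and p: "set es \<subseteq> edges G" using es
      by (auto simp: reduced_closed_path_def is_path_def)
    then have m: "es ! i \<in> edges G" if "i < length es" for i using that nth_mem by blast
    have "set (map ?F es) \<subseteq> edges H" using p E graph_isoD(2)[OF f] by fastforce
    moreover have "?F (hd es) \<noteq> prod.swap (?F (last es))"
      using swap[of "hd es" "last es"] es ne p
      by (metis (mono_tags, lifting) hd_in_set last_in_set mem_Collect_eq reduced_closed_path_def
          subset_iff swap_swap)
    then have "prod.swap (?F (hd es)) \<noteq> ?F (last es)" by (metis swap_swap)
    ultimately show ?thesis
      using es ne m swap unfolding reduced_closed_path_def is_path_def
      by (auto simp: hd_map last_map)
  qed
  moreover have "inj_on (map ?F) ?S"
  proof -
    have "inj_on ?F (edges G)" using map_prod_inj_on[OF inj inj] E by (rule inj_on_subset)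
    then have "inj_on (map ?F) (lists (edges G))" by (rule inj_on_map_lists)
    then show ?thesis
      by (rule inj_on_subset) (auto simp: reduced_closed_path_def is_path_def)
  qed
  moreover obtain D where "degree_bounded D H" using g(2) by (auto simp: is_graph_def)
  then have "finite ?T" using num_rcp_le(2)[OF g(2) _ graph_isoD(3)[OF f g(3)]] Suc by simp
  ultimately show ?thesis unfolding num_rcp_def by (intro card_inj_on_le[of "map ?F"]) auto
qed simp

lemma num_rcp_rooted_iso:
  assumes "is_rooted (A, x)" "is_rooted (B, y)" "rooted_iso (A, x) (B, y)"
  shows "num_rcp A j x = num_rcp B j y"
proof -
  have *: "num_rcp A j x \<le> num_rcp B j y"
    if "is_rooted (A, x)" "is_rooted (B, y)" "rooted_iso (A, x) (B, y)"
    for A :: "'c graph" and B :: "'d graph" and x y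
    using that num_rcp_graph_iso_le[of _ A B x j] by (auto simp: is_rooted_def rooted_iso_def)
  show ?thesis
    using *[OF assms] *[OF assms(2,1) rooted_iso_sym[OF assms(1,3)]] by simp
qed

lemma class_num_rcp_ball_class:
  assumes "is_graph G" "x \<in> verts G"
  shows "class_num_rcp j (ball_class G j x) = num_rcp G j x"
proof -
  obtain A y where A: "(SOME H. H \<in> ball_class G j x) = (A, y)" by fastforce
  then have "(A, y) \<in> iso_class (rooted_ball G j x)"
    using ball_class_representative[OF assms, of j] by (simp add: ball_class_def)
  then have iso: "is_rooted (A, y)" "rooted_iso (A, y) (rooted_ball G j x)"
    using iso_class_members[OF is_rooted_ball[OF assms]] by auto
  have x: "rooted_ball G j x = (fst (rooted_ball G j x), x)" by (simp add: rooted_ball_eq)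
  have "num_rcp A j y = num_rcp (fst (rooted_ball G j x)) j x"
    using iso x is_rooted_ball[OF assms, of j] by (intro num_rcp_rooted_iso) metis+
  then show ?thesis by (simp add: class_num_rcp_def A num_rcp_ball[OF assms])
qed

section \<open>Masses of classes in a measure graph\<close>

locale bounded_measure_graph =
  fixes D :: nat and X :: "('g, 'v) measure_graph" and u :: "'v \<Rightarrow> ennreal"
  assumes measure_graph: "is_measure_graph X"
    and degree: "degree_bounded D (graph_of X)"
    and averaging: "averaging_function X u"
begin

lemma graph: "is_graph (graph_of X)"
  and ball_class_measurable: "ball_class (graph_of X) r \<in> vmeas X \<rightarrow>\<^sub>M count_space UNIV"
  using measure_graph
  by (auto simp: is_measure_graph_def graph_over_def measurable_graph_def graph_of_def)

lemma weight_measurable [measurable]: "u \<in> borel_measurable (vmeas X)"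
  using averaging by (simp add: averaging_function_def is_averaging_def)

lemma verts_graph [simp]: "verts (graph_of X) = space (vmeas X)"
  by (simp add: graph_of_def mk_graph_def)

lemma ball_class_sets [measurable]:
  "{x \<in> space (vmeas X). ball_class (graph_of X) k x = \<alpha>} \<in> sets (vmeas X)"
  using measurable_sets[OF ball_class_measurable[of k], of "{\<alpha>}"]
  by (simp add: vimage_def Int_def conj_commute)

lemma class_mass_eq:
  assumes "\<alpha> \<in> classes_radius D r"
  shows "class_mass X u \<alpha> =
    (\<integral>\<^sup>+x. u x * indicator {x \<in> space (vmeas X). ball_class (graph_of X) r x = \<alpha>} x \<partial>vmeas X)"
  by (simp add: class_mass_def verts_class_def class_radius_eq[OF assms])

lemma class_mass_fin_eq:
  assumes "\<alpha> \<in> classes_radius D r" "r < k"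
  shows "class_mass_fin X u \<alpha> =
    (\<integral>\<^sup>+x. u x * indicator {x \<in> space (vmeas X). ball_class (graph_of X) k x = \<alpha>} x \<partial>vmeas X)"
  by (simp add: class_mass_fin_def verts_fin_inter_class[OF graph assms])

text \<open>
  Sort the vertices by the class of their ball of radius \<open>k\<close>.  Either this class has radius \<open>k\<close>, or
  it has a smaller radius \<open>r\<close>; in the second case the ball is the whole component, which therefore
  is finite of radius \<open>r\<close>.  This is the reason for the two kinds of masses in the limit coefficients.
\<close>

lemma nn_integral_ball_class:
  "(\<integral>\<^sup>+x. f (ball_class (graph_of X) k x) * u x \<partial>vmeas X) =
    (\<Sum>\<alpha>\<in>classes_radius D k. f \<alpha> * class_mass X u \<alpha>) +
    (\<Sum>r<k. \<Sum>\<alpha>\<in>classes_radius D r. f \<alpha> * class_mass_fin X u \<alpha>)"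
proof -
  let ?b = "ball_class (graph_of X) k"
  let ?I = "\<lambda>\<alpha>. indicator {x \<in> space (vmeas X). ?b x = \<alpha>} :: 'v \<Rightarrow> ennreal"
  have "f (?b x) * u x = (\<Sum>r\<le>k. \<Sum>\<alpha>\<in>classes_radius D r. f \<alpha> * (u x * ?I \<alpha> x))"
    if x: "x \<in> space (vmeas X)" for x
  proof -
    define s where "s = radius (rooted_ball (graph_of X) k x)"
    have s: "?b x \<in> classes_radius D s" "s \<le> k"
      unfolding s_def using x graph degree
      by (auto intro: ball_class_in_classes radius_rooted_ball_le)
    have "(\<Sum>\<alpha>\<in>classes_radius D r. f \<alpha> * (u x * ?I \<alpha> x)) = (if r = s then f (?b x) * u x else 0)" for r
    proof (cases "r = s")
      case True
      have "(\<Sum>\<alpha>\<in>classes_radius D r. f \<alpha> * (u x * ?I \<alpha> x))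
          = (\<Sum>\<alpha>\<in>classes_radius D r. if \<alpha> = ?b x then f \<alpha> * u x else 0)"
        using x by (intro sum.cong) auto
      then show ?thesis using True s by (simp add: finite_classes_radius)
    next
      case False
      have "?b x \<notin> classes_radius D r" using class_radius_eq s(1) False by blast
      then have "f \<alpha> * (u x * ?I \<alpha> x) = 0" if "\<alpha> \<in> classes_radius D r" for \<alpha>
        using that by (auto simp: indicator_def)
      then show ?thesis using False by (simp add: sum.neutral)
    qed
    then show ?thesis using s(2) by simp
  qed
  then have "(\<integral>\<^sup>+x. f (?b x) * u x \<partial>vmeas X) =
      (\<integral>\<^sup>+x. (\<Sum>r\<le>k. \<Sum>\<alpha>\<in>classes_radius D r. f \<alpha> * (u x * ?I \<alpha> x)) \<partial>vmeas X)"
    by (rule nn_integral_cong)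
  also have "\<dots> = (\<Sum>r\<le>k. \<Sum>\<alpha>\<in>classes_radius D r. f \<alpha> * (\<integral>\<^sup>+x. u x * ?I \<alpha> x \<partial>vmeas X))"
    by (simp add: nn_integral_sum nn_integral_cmult)
  also have "\<dots> = (\<Sum>\<alpha>\<in>classes_radius D k. f \<alpha> * class_mass X u \<alpha>) +
      (\<Sum>r<k. \<Sum>\<alpha>\<in>classes_radius D r. f \<alpha> * class_mass_fin X u \<alpha>)"
    by (simp add: lessThan_Suc_atMost[symmetric] class_mass_eq class_mass_fin_eq add.commute)
  finally show ?thesis .
qed

text \<open>
  Balls of radius \<open>0\<close> are single vertices, so weak convergence controls the total masses.
\<close>

lemma total_mass: "(\<integral>\<^sup>+x. u x \<partial>vmeas X) = (\<Sum>\<alpha>\<in>classes_radius D 0. class_mass X u \<alpha>)"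
  using nn_integral_ball_class[of "\<lambda>_. 1" 0] by simp

lemma mean_rcp_eq:
  "mean_rcp X u j =
    (\<Sum>\<alpha>\<in>classes_radius D j. of_nat (class_num_rcp j \<alpha>) * class_mass X u \<alpha>) +
    (\<Sum>r<j. \<Sum>\<alpha>\<in>classes_radius D r. of_nat (class_num_rcp j \<alpha>) * class_mass_fin X u \<alpha>)"
  unfolding mean_rcp_def nn_integral_ball_class[of "\<lambda>\<alpha>. of_nat (class_num_rcp j \<alpha>)" j, symmetric]
  by (intro nn_integral_cong) (simp add: class_num_rcp_ball_class graph)

lemma mean_rcp_le: "mean_rcp X u (Suc n) \<le> of_nat (D * (D - 1) ^ n) * (\<integral>\<^sup>+x. u x \<partial>vmeas X)"
proof -
  have "mean_rcp X u (Suc n) \<le> (\<integral>\<^sup>+x. of_nat (D * (D - 1) ^ n) * u x \<partial>vmeas X)"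
    unfolding mean_rcp_def using num_rcp_le(1)[OF graph degree]
    by (intro nn_integral_mono mult_right_mono) (auto simp del: of_nat_mult of_nat_power)
  then show ?thesis by (simp add: nn_integral_cmult)
qed

text \<open>
  Suppose that the ball of radius \<open>r\<close> around \<open>x\<close> has class \<open>\<alpha>\<close>.  Either it does not grow when the
  radius is increased to \<open>r + 1\<close>, and then it is the component of \<open>x\<close>; or the larger ball has one
  of the finitely many classes of radius \<open>r + 1\<close> that truncate to \<open>\<alpha>\<close>.  Hence the mass of the
  finite components is a difference of masses that are known to converge.
\<close>

lemma class_mass_split:
  assumes \<alpha>: "\<alpha> \<in> classes_radius D r"
  shows "class_mass X u \<alpha> = class_mass_fin X u \<alpha> +
    (\<Sum>\<beta>\<in>{\<beta> \<in> classes_radius D (Suc r). truncate_class r \<beta> = \<alpha>}. class_mass X u \<beta>)"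
proof -
  let ?b = "ball_class (graph_of X)"
  let ?I = "\<lambda>k. indicator {x \<in> space (vmeas X). ?b k x = \<alpha>} :: 'v \<Rightarrow> ennreal"
  \<comment> \<open>\<open>f\<close> selects the vertices whose ball of class \<open>\<alpha>\<close> does grow; it vanishes on all classes of
    radius at most \<open>r\<close>, so that no masses of finite components enter its integral.\<close>
  define f :: "rclass \<Rightarrow> ennreal"
    where "f \<beta> = (if class_radius \<beta> = Suc r \<and> truncate_class r \<beta> = \<alpha> then 1 else 0)" for \<beta>
  have "u x * ?I r x = u x * ?I (Suc r) x + f (?b (Suc r) x) * u x" if x: "x \<in> space (vmeas X)" for x
  proof (cases "radius (rooted_ball (graph_of X) (Suc r) x) = Suc r")
    case True
    then have "class_radius (?b (Suc r) x) = Suc r"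
      using class_radius_ball_class[OF graph] x by simp
    moreover from this have "?b (Suc r) x \<noteq> \<alpha>" using class_radius_eq[OF \<alpha>] by auto
    ultimately show ?thesis
      using x truncate_ball_class[OF graph, of x r "Suc r"] by (auto simp: f_def indicator_def)
  next
    case False
    then have less: "radius (rooted_ball (graph_of X) (Suc r) x) < Suc r"
      using radius_rooted_ball_le[OF graph, of x "Suc r"] x by simp
    then have "?b r x = ?b (Suc r) x"
      using ball_stable_of_radius_less[OF graph _ refl less, of r] x by (simp add: ball_class_def)
    moreover have "f (?b (Suc r) x) = 0"
      using False class_radius_ball_class[OF graph] x by (simp add: f_def)
    ultimately show ?thesis using x by (simp add: indicator_def)
  qed
  then have "class_mass X u \<alpha> = (\<integral>\<^sup>+x. u x * ?I (Suc r) x + f (?b (Suc r) x) * u x \<partial>vmeas X)"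
    unfolding class_mass_eq[OF \<alpha>] by (rule nn_integral_cong)
  also have "\<dots> = (\<integral>\<^sup>+x. u x * ?I (Suc r) x \<partial>vmeas X) + (\<integral>\<^sup>+x. f (?b (Suc r) x) * u x \<partial>vmeas X)"
    using measurable_compose[OF ball_class_measurable[of "Suc r"], of f borel]
    by (intro nn_integral_add) auto
  also have "(\<integral>\<^sup>+x. u x * ?I (Suc r) x \<partial>vmeas X) = class_mass_fin X u \<alpha>"
    using class_mass_fin_eq[OF \<alpha>, of "Suc r"] by simp
  also have "(\<integral>\<^sup>+x. f (?b (Suc r) x) * u x \<partial>vmeas X) =
      (\<Sum>\<beta>\<in>classes_radius D (Suc r). f \<beta> * class_mass X u \<beta>)"
  proof -
    have "f \<beta> = 0" if "s < Suc r" "\<beta> \<in> classes_radius D s" for s \<beta>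
      using that class_radius_eq by (auto simp: f_def)
    then show ?thesis by (simp add: nn_integral_ball_class[of f] sum.neutral)
  qed
  also have "\<dots> = (\<Sum>\<beta>\<in>classes_radius D (Suc r). if truncate_class r \<beta> = \<alpha> then class_mass X u \<beta> else 0)"
    by (intro sum.cong) (auto simp: f_def class_radius_eq)
  finally show ?thesis by (simp add: sum.inter_filter finite_classes_radius)
qed

end

section \<open>Limits along a weakly convergent sequence\<close>

locale weakly_convergent_sequence =
  fixes D :: nat and G :: "nat \<Rightarrow> ('g, 'v) measure_graph" and u :: "nat \<Rightarrow> 'v \<Rightarrow> ennreal"
  assumes measure_graphs: "\<And>n. is_measure_graph (G n)"
    and degrees: "\<And>n. degree_bounded D (graph_of (G n))"
    and averagings: "\<And>n. averaging_function (G n) (u n)"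
    and convergent: "weakly_convergent D G u"
begin

lemma bounded: "bounded_measure_graph D (G n) (u n)"
  using measure_graphs degrees averagings by (simp add: bounded_measure_graph_def)

lemma class_mass_tendsto:
  assumes "\<alpha> \<in> classes_radius D r"
  shows "(\<lambda>n. class_mass (G n) (u n) \<alpha>) \<longlonglongrightarrow> ennreal (lim_mass G u \<alpha>)"
proof -
  have "\<alpha> \<in> classes D" using assms by (auto simp: classes_def)
  then obtain L where L: "L < \<infinity>" "(\<lambda>n. class_mass (G n) (u n) \<alpha>) \<longlonglongrightarrow> L"
    using convergent by (auto simp: weakly_convergent_def)
  then show ?thesis by (simp add: lim_mass_def limI)
qed

text \<open>
  The limit mass of the vertices whose ball of radius \<open>r\<close> has class \<open>\<alpha>\<close> but is not their whole
  component.
\<close>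

definition child_mass :: "nat \<Rightarrow> rclass \<Rightarrow> real" where
  "child_mass r \<alpha> = (\<Sum>\<beta>\<in>{\<beta> \<in> classes_radius D (Suc r). truncate_class r \<beta> = \<alpha>}. lim_mass G u \<beta>)"

lemma lim_mass_nonneg: "lim_mass G u \<alpha> \<ge> 0"
  by (simp add: lim_mass_def)

text \<open>
  The splitting of class masses determines the masses of finite components from the class masses.
  This holds for a weak limit as well as along the sequence, so a weak limit has the limit values of
  both kinds of masses.
\<close>

lemma class_mass_fin_of_limit:
  assumes X: "bounded_measure_graph D X w" and \<alpha>: "\<alpha> \<in> classes_radius D r"
    and mass: "\<And>\<beta>. \<beta> \<in> classes D \<Longrightarrow> class_mass X w \<beta> = ennreal (lim_mass G u \<beta>)"
  shows "class_mass_fin X w \<alpha> = ennreal (lim_mass G u \<alpha>) - ennreal (child_mass r \<alpha>)"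
proof -
  have c: "\<beta> \<in> classes D" if "\<beta> \<in> classes_radius D s" for \<beta> s using that by (auto simp: classes_def)
  have "(\<Sum>\<beta>\<in>{\<beta> \<in> classes_radius D (Suc r). truncate_class r \<beta> = \<alpha>}. class_mass X w \<beta>)
      = ennreal (child_mass r \<alpha>)"
    unfolding child_mass_def sum_ennreal[OF lim_mass_nonneg, symmetric]
    by (rule sum.cong[OF refl]) (auto intro: mass c)
  then have "ennreal (lim_mass G u \<alpha>) = class_mass_fin X w \<alpha> + ennreal (child_mass r \<alpha>)"
    using bounded_measure_graph.class_mass_split[OF X \<alpha>] mass[OF c[OF \<alpha>]] by simp
  then show ?thesis by simp
qed

lemma class_mass_fin_tendsto':
  assumes \<alpha>: "\<alpha> \<in> classes_radius D r"
  shows "(\<lambda>n. class_mass_fin (G n) (u n) \<alpha>)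
    \<longlonglongrightarrow> ennreal (lim_mass G u \<alpha>) - ennreal (child_mass r \<alpha>)"
proof -
  let ?ch = "{\<beta> \<in> classes_radius D (Suc r). truncate_class r \<beta> = \<alpha>}"
  have ch: "(\<lambda>n. \<Sum>\<beta>\<in>?ch. class_mass (G n) (u n) \<beta>) \<longlonglongrightarrow> ennreal (child_mass r \<alpha>)"
    unfolding child_mass_def sum_ennreal[OF lim_mass_nonneg, symmetric]
    by (intro tendsto_sum class_mass_tendsto) auto
  have "(\<lambda>n. class_mass (G n) (u n) \<alpha> - (\<Sum>\<beta>\<in>?ch. class_mass (G n) (u n) \<beta>))
      \<longlonglongrightarrow> ennreal (lim_mass G u \<alpha>) - ennreal (child_mass r \<alpha>)"
    by (intro tendsto_diff_ennreal_general class_mass_tendsto[OF \<alpha>] ch) auto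
  \<comment> \<open>Subtraction inverts the splitting as soon as the subtrahend is finite.\<close>
  moreover have "eventually (\<lambda>n. class_mass (G n) (u n) \<alpha> - (\<Sum>\<beta>\<in>?ch. class_mass (G n) (u n) \<beta>)
      = class_mass_fin (G n) (u n) \<alpha>) sequentially"
    using order_tendstoD(2)[OF ch, of \<infinity>, simplified]
  proof eventually_elim
    case (elim n)
    then show ?case
      using bounded_measure_graph.class_mass_split[OF bounded[of n] \<alpha>] by (auto simp: less_top)
  qed
  ultimately show ?thesis by (rule Lim_transform_eventually)
qed

lemma lim_mass_fin_eq:
  assumes "\<alpha> \<in> classes_radius D r"
  shows "ennreal (lim_mass_fin G u \<alpha>) = ennreal (lim_mass G u \<alpha>) - ennreal (child_mass r \<alpha>)"
  unfolding lim_mass_fin_def limI[OF class_mass_fin_tendsto'[OF assms]]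
  by (subst ennreal_enn2real) (auto intro: le_less_trans[OF diff_le_self_ennreal])

lemma class_mass_fin_tendsto:
  assumes "\<alpha> \<in> classes_radius D r"
  shows "(\<lambda>n. class_mass_fin (G n) (u n) \<alpha>) \<longlonglongrightarrow> ennreal (lim_mass_fin G u \<alpha>)"
  unfolding lim_mass_fin_eq[OF assms] by (rule class_mass_fin_tendsto'[OF assms])

lemma lim_mass_fin_nonneg: "lim_mass_fin G u \<alpha> \<ge> 0"
  by (simp add: lim_mass_fin_def)

lemma lim_coeff_nonneg: "lim_coeff D G u j \<ge> 0"
  unfolding lim_coeff_def using lim_mass_nonneg lim_mass_fin_nonneg
  by (intro add_nonneg_nonneg sum_nonneg mult_nonneg_nonneg) auto

lemma ennreal_lim_coeff:
  "ennreal (lim_coeff D G u j) =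
    (\<Sum>\<alpha>\<in>classes_radius D j. of_nat (class_num_rcp j \<alpha>) * ennreal (lim_mass G u \<alpha>)) +
    (\<Sum>r<j. \<Sum>\<alpha>\<in>classes_radius D r. of_nat (class_num_rcp j \<alpha>) * ennreal (lim_mass_fin G u \<alpha>))"
  by (simp add: lim_coeff_def sum_nonneg lim_mass_nonneg lim_mass_fin_nonneg ennreal_mult
      ennreal_of_nat_eq_real_of_nat flip: sum_ennreal)

lemma mean_rcp_tendsto: "(\<lambda>n. mean_rcp (G n) (u n) j) \<longlonglongrightarrow> ennreal (lim_coeff D G u j)"
  unfolding ennreal_lim_coeff bounded_measure_graph.mean_rcp_eq[OF bounded]
  by (intro tendsto_add tendsto_sum ennreal_tendsto_cmult class_mass_tendsto class_mass_fin_tendsto)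
    (auto simp: of_nat_less_top)

lemma mean_rcp_weak_limit:
  assumes X: "bounded_measure_graph D X w" and lim: "weak_limit D G u X w"
  shows "mean_rcp X w j = ennreal (lim_coeff D G u j)"
proof -
  have mass: "class_mass X w \<beta> = ennreal (lim_mass G u \<beta>)" if "\<beta> \<in> classes D" for \<beta>
    using lim that by (simp add: weak_limit_def)
  then have "class_mass X w \<alpha> = ennreal (lim_mass G u \<alpha>)"
      "class_mass_fin X w \<alpha> = ennreal (lim_mass_fin G u \<alpha>)" if "\<alpha> \<in> classes_radius D r" for \<alpha> r
    using class_mass_fin_of_limit[OF X that mass] lim_mass_fin_eq[OF that] that
    by (auto simp: classes_def)
  then show ?thesis unfolding ennreal_lim_coeff bounded_measure_graph.mean_rcp_eq[OF X] by simp
qed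

lemma mean_rcp_bound:
  obtains C where
    "eventually (\<lambda>n. \<forall>j. enn2real (mean_rcp (G n) (u n) (Suc j)) \<le> C * real D * real (D - 1) ^ j) sequentially"
proof -
  define T where "T = (\<Sum>\<alpha>\<in>classes_radius D 0. lim_mass G u \<alpha>)"
  have "T \<ge> 0" by (simp add: T_def sum_nonneg lim_mass_nonneg)
  have "(\<lambda>n. \<integral>\<^sup>+x. u n x \<partial>vmeas (G n)) \<longlonglongrightarrow> ennreal T"
    unfolding bounded_measure_graph.total_mass[OF bounded] T_def
      sum_ennreal[OF lim_mass_nonneg, symmetric]
    by (intro tendsto_sum class_mass_tendsto)
  then have "eventually (\<lambda>n. (\<integral>\<^sup>+x. u n x \<partial>vmeas (G n)) < ennreal (T + 1)) sequentially"
    by (rule order_tendstoD(2)) (use \<open>T \<ge> 0\<close> in \<open>simp add: ennreal_less_iff\<close>)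
  then have "eventually (\<lambda>n. \<forall>j. enn2real (mean_rcp (G n) (u n) (Suc j)) \<le> (T + 1) * real D * real (D - 1) ^ j) sequentially"
  proof eventually_elim
    case (elim n)
    show ?case
    proof
      fix j
      have "mean_rcp (G n) (u n) (Suc j) \<le> of_nat (D * (D - 1) ^ j) * ennreal (T + 1)"
        by (rule order_trans[OF bounded_measure_graph.mean_rcp_le[OF bounded]])
          (intro mult_left_mono less_imp_le[OF elim] zero_le)
      also have "\<dots> = ennreal (real (D * (D - 1) ^ j) * (T + 1))"
        using \<open>T \<ge> 0\<close> by (simp add: ennreal_of_nat_eq_real_of_nat ennreal_mult del: of_nat_mult of_nat_power)
      finally show "enn2real (mean_rcp (G n) (u n) (Suc j)) \<le> (T + 1) * real D * real (D - 1) ^ j"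
        using \<open>T \<ge> 0\<close> by (intro enn2real_leI) (auto simp: mult_ac)
    qed
  qed
  then show ?thesis by (rule that)
qed

end

section \<open>Convergence of power series\<close>

text \<open>
  On the disc of radius \<open>\<rho>\<close> the difference of the two power series is at most
  \<open>\<Sum>j. \<bar>a n j - b j\<bar> * \<rho> ^ (j + 1)\<close>.  This number does not depend on the point of the disc and tends
  to \<open>0\<close> by dominated convergence.
\<close>

lemma uniform_limit_power_series:
  fixes a :: "nat \<Rightarrow> nat \<Rightarrow> complex"
  assumes lim: "\<And>j. (\<lambda>n. a n j) \<longlonglongrightarrow> b j"
    and bound: "eventually (\<lambda>n. \<forall>j. norm (a n j) \<le> M j) sequentially"
    and M: "summable (\<lambda>j. M j * \<rho> ^ Suc j)" and \<rho>: "\<rho> \<ge> 0"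
  shows "uniform_limit (cball 0 \<rho>) (\<lambda>n z. \<Sum>j. a n j * z ^ Suc j) (\<lambda>z. \<Sum>j. b j * z ^ Suc j) sequentially"
proof (rule uniform_limitI)
  fix e :: real assume "e > 0"
  have b: "norm (b j) \<le> M j" for j
    by (rule tendsto_upperbound[OF tendsto_norm[OF lim]]) (use bound in \<open>auto elim: eventually_mono\<close>)
  have diff: "norm (norm (a n j - b j) * \<rho> ^ Suc j) \<le> 2 * (M j * \<rho> ^ Suc j)"
    if "\<forall>j. norm (a n j) \<le> M j" for n j
  proof -
    have "norm (a n j - b j) \<le> 2 * M j"
      using norm_triangle_ineq4[of "a n j" "b j"] that[rule_format, of j] b[of j] by simp
    then show ?thesis
      using \<rho> mult_right_mono[of "norm (a n j - b j)" "2 * M j" "\<rho> ^ Suc j"] by simp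
  qed
  have M2: "summable (\<lambda>j. 2 * (M j * \<rho> ^ Suc j))" by (intro summable_mult M)
  have "eventually (\<lambda>(j, n). norm (norm (a n j - b j) * \<rho> ^ Suc j) \<le> 2 * (M j * \<rho> ^ Suc j))
      (at_top \<times>\<^sub>F sequentially)"
    using eventually_prodI[OF eventually_True bound, of at_top] diff
    by (auto elim!: eventually_mono)
  moreover have "(\<lambda>n. norm (a n j - b j) * \<rho> ^ Suc j) \<longlonglongrightarrow> 0" for j
    using tendsto_mult[OF tendsto_norm[OF tendsto_diff[OF lim tendsto_const]] tendsto_const, of j "b j" "\<rho> ^ Suc j"]
    by simp
  ultimately have "(\<lambda>n. \<Sum>j. norm (a n j - b j) * \<rho> ^ Suc j) \<longlonglongrightarrow> (\<Sum>j. 0)"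
    using M2 tannerys_theorem[of "\<lambda>j n. norm (a n j - b j) * \<rho> ^ Suc j" "\<lambda>_. 0" sequentially
        "\<lambda>j. 2 * (M j * \<rho> ^ Suc j)"] by simp
  then have "eventually (\<lambda>n. (\<Sum>j. norm (a n j - b j) * \<rho> ^ Suc j) < e) sequentially"
    using order_tendstoD(2) \<open>e > 0\<close> by fastforce
  then show "\<forall>\<^sub>F n in sequentially. \<forall>z\<in>cball 0 \<rho>.
      dist (\<Sum>j. a n j * z ^ Suc j) (\<Sum>j. b j * z ^ Suc j) < e"
    using bound
  proof eventually_elim
    case (elim n)
    show ?case
    proof
      fix z :: complex assume "z \<in> cball 0 \<rho>"
      then have z: "norm z ^ Suc j \<le> \<rho> ^ Suc j" for j by (intro power_mono) auto
      have sm: "summable (\<lambda>j. c j * z ^ Suc j)" if c: "\<And>j. norm (c j) \<le> M j" for c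
      proof (rule summable_comparison_test[OF _ M], intro exI allI impI)
        fix j show "norm (c j * z ^ Suc j) \<le> M j * \<rho> ^ Suc j"
          unfolding norm_mult norm_power
          by (rule mult_mono[OF c z]) (use order_trans[OF norm_ge_zero c[of j]] in auto)
      qed
      have dm: "summable (\<lambda>j. norm (a n j - b j) * \<rho> ^ Suc j)"
        by (rule summable_comparison_test[OF _ M2]) (use diff[OF elim(2)] in blast)
      have "(\<Sum>j. a n j * z ^ Suc j) - (\<Sum>j. b j * z ^ Suc j) = (\<Sum>j. (a n j - b j) * z ^ Suc j)"
        using sm[of "a n"] sm[of b] elim(2) b by (simp add: suminf_diff left_diff_distrib)
      also have "norm \<dots> \<le> (\<Sum>j. norm (a n j - b j) * \<rho> ^ Suc j)"
        using z by (intro norm_suminf_le dm) (auto simp: norm_mult norm_power intro!: mult_left_mono)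
      finally show "dist (\<Sum>j. a n j * z ^ Suc j) (\<Sum>j. b j * z ^ Suc j) < e"
        using elim(1) by (simp add: dist_norm)
    qed
  qed
qed

text \<open>
  The exponential function is uniformly continuous on bounded sets, but not on the whole plane,
  whence the bound on the limit.
\<close>

lemma uniform_limit_exp:
  fixes g :: "nat \<Rightarrow> 'a \<Rightarrow> complex"
  assumes lim: "uniform_limit A g h sequentially" and bound: "\<And>z. z \<in> A \<Longrightarrow> norm (h z) \<le> B"
  shows "uniform_limit A (\<lambda>n z. exp (g n z)) (\<lambda>z. exp (h z)) sequentially"
proof (rule uniform_limit_compose_uniformly_continuous_on[OF lim])
  show "uniformly_continuous_on (cball 0 (B + 1)) (exp :: complex \<Rightarrow> complex)"
    by (intro compact_uniformly_continuous continuous_intros) auto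
  show "\<forall>\<^sub>F n in sequentially. \<forall>z\<in>A. g n z \<in> cball 0 (B + 1)"
    using uniform_limitD[OF lim zero_less_one]
  proof eventually_elim
    case (elim n)
    have "norm (g n z) \<le> B + 1" if "z \<in> A" for z
      using elim that bound[OF that] norm_triangle_ineq2[of "g n z" "h z"]
      by (fastforce simp: dist_norm)
    then show ?case by simp
  qed
qed simp

text \<open>Multiplied out, the inequality also describes the whole plane, which is the disc for \<open>D = 1\<close>.\<close>

lemma zeta_disc_iff:
  assumes "D > 0"
  shows "z \<in> zeta_disc D \<longleftrightarrow> cmod z * real (D - 1) < 1"
proof (cases "D = 1")
  case False
  then have "real D - 1 > 0" "real (D - 1) = real D - 1" using assms by auto
  then show ?thesis by (simp add: zeta_disc_def field_simps)
qed (simp add: zeta_disc_def zero_ereal_def[symmetric])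

lemma zeta_disc_compact:
  assumes "D > 0" "compact K" "K \<subseteq> zeta_disc D"
  obtains \<rho> where "\<rho> \<ge> 0" "\<rho> * real (D - 1) < 1" "K \<subseteq> cball 0 \<rho>"
proof (cases "K = {}")
  case False
  then obtain w where w: "w \<in> K" "\<forall>z\<in>K. cmod z \<le> cmod w"
    using continuous_attains_sup[OF assms(2), of cmod] by (auto intro: continuous_intros)
  then show ?thesis using assms zeta_disc_iff[of D w] by (intro that[of "cmod w"]) auto
qed (rule that[of 0], auto)

lemma zeta_disc_larger_radius:
  assumes "D > 0" "z \<in> zeta_disc D"
  obtains \<rho> where "cmod z < \<rho>" "\<rho> * real (D - 1) < 1"
proof -
  have z: "cmod z * real (D - 1) < 1" using assms zeta_disc_iff by blast
  show ?thesis
  proof (cases "D = 1")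
    case False
    then have "real (D - 1) > 0" using assms by simp
    then have "cmod z < 1 / real (D - 1)" using z by (simp add: field_simps)
    then obtain \<rho> where "cmod z < \<rho>" "\<rho> < 1 / real (D - 1)" using dense by blast
    then show ?thesis using \<open>real (D - 1) > 0\<close> by (intro that[of \<rho>]) (auto simp: field_simps)
  qed (rule that[of "cmod z + 1"], auto)
qed

lemma summable_geometric_bound:
  assumes "\<rho> \<ge> 0" "\<rho> * real (D - 1) < 1"
  shows "summable (\<lambda>j. C * real D * real (D - 1) ^ j * \<rho> ^ Suc j)"
proof -
  have "summable (\<lambda>j. (C * real D * \<rho>) * (\<rho> * real (D - 1)) ^ j)"
    using assms by (intro summable_mult summable_geometric) auto
  then show ?thesis by (simp add: power_mult_distrib mult_ac)
qed

lemma summable_power_series: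
  fixes b :: "nat \<Rightarrow> complex"
  assumes b: "\<And>j. norm (b j) \<le> C * real D * real (D - 1) ^ j"
    and z: "cmod z \<le> \<rho>" "\<rho> * real (D - 1) < 1"
  shows "summable (\<lambda>j. norm (b j * z ^ Suc j))"
    "norm (\<Sum>j. b j * z ^ Suc j) \<le> (\<Sum>j. C * real D * real (D - 1) ^ j * \<rho> ^ Suc j)"
proof -
  have \<rho>: "\<rho> \<ge> 0" using z(1) norm_ge_zero order_trans by blast
  have le: "norm (b j * z ^ Suc j) \<le> C * real D * real (D - 1) ^ j * \<rho> ^ Suc j" for j
    unfolding norm_mult norm_power
    by (rule mult_mono[OF b power_mono[OF z(1)]]) (use order_trans[OF norm_ge_zero b[of j]] in auto)
  note sm = summable_geometric_bound[OF \<rho> z(2), of C]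
  show "summable (\<lambda>j. norm (b j * z ^ Suc j))"
    by (rule summable_comparison_test[OF _ sm]) (use le in auto)
  show "norm (\<Sum>j. b j * z ^ Suc j) \<le> (\<Sum>j. C * real D * real (D - 1) ^ j * \<rho> ^ Suc j)"
    by (rule norm_suminf_le[OF le sm])
qed

lemma holomorphic_power_series:
  fixes b :: "nat \<Rightarrow> complex"
  assumes "D > 0" and b: "\<And>j. norm (b j) \<le> C * real D * real (D - 1) ^ j"
  shows "(\<lambda>z. \<Sum>j. b j * z ^ Suc j) holomorphic_on zeta_disc D"
  unfolding holomorphic_on_def
proof
  fix z assume z: "z \<in> zeta_disc D"
  obtain \<rho> where \<rho>: "cmod z < \<rho>" "\<rho> * real (D - 1) < 1" using zeta_disc_larger_radius[OF \<open>D > 0\<close> z] .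
  have "\<rho> > 0" using \<rho>(1) norm_ge_zero[of z] by linarith
  have sm: "summable (\<lambda>j. b j * w ^ j)" if w: "cmod w \<le> \<rho>" for w
  proof (cases "w = 0")
    case False
    \<comment> \<open>Lower the exponents by one, to reach a power series in standard form.\<close>
    have "summable (\<lambda>j. b j * w ^ Suc j)"
      using summable_power_series(1)[OF b w \<rho>(2)] by (rule summable_norm_cancel)
    then have "summable (\<lambda>j. inverse w * (b j * w ^ Suc j))" by (rule summable_mult)
    moreover have "inverse w * (b j * w ^ Suc j) = b j * w ^ j" for j using False by simp
    ultimately show ?thesis by (simp only:)
  qed (auto intro!: summable_finite[of "{0}"] simp: power_0_left split: if_splits)
  have "((\<lambda>w. \<Sum>j. b j * w ^ j) has_field_derivative (\<Sum>j. diffs b j * z ^ j)) (at z)"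
    by (rule termdiffs_strong'[of \<rho>]) (use sm \<rho>(1) in auto)
  then have "(\<lambda>w. w * (\<Sum>j. b j * w ^ j)) field_differentiable at z"
    by (intro field_differentiable_mult) (auto simp: field_differentiable_def)
  moreover have ev: "eventually (\<lambda>w. w * (\<Sum>j. b j * w ^ j) = (\<Sum>j. b j * w ^ Suc j)) (nhds z)"
  proof -
    have "w * (\<Sum>j. b j * w ^ j) = (\<Sum>j. b j * w ^ Suc j)" if "w \<in> ball 0 \<rho>" for w
      using suminf_mult[OF sm, of w w] that by (simp add: mult_ac)
    then show ?thesis using \<rho>(1) unfolding eventually_nhds
      by (intro exI[of _ "ball 0 \<rho>"]) auto
  qed
  ultimately have "(\<lambda>w. \<Sum>j. b j * w ^ Suc j) field_differentiable at z"
    unfolding field_differentiable_def DERIV_cong_ev[OF refl ev refl] by blast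
  then show "(\<lambda>w. \<Sum>j. b j * w ^ Suc j) field_differentiable at z within zeta_disc D"
    by (rule field_differentiable_at_within)
qed

theorem theorem5p7:
  fixes D :: nat
    and G :: "nat \<Rightarrow> ('g, 'v) measure_graph"
    and u :: "nat \<Rightarrow> 'v \<Rightarrow> ennreal"
  assumes "D > 0"
    and "\<And>n. is_measure_graph (G n)"
    and "\<And>n. degree_bounded D (graph_of (G n))"
    and "\<And>n. averaging_function (G n) (u n)"
    and "weakly_convergent D G u"
  shows "\<exists>Z. Z holomorphic_on zeta_disc D \<and>
    (\<forall>K. compact K \<and> K \<subseteq> zeta_disc D \<longrightarrow>
       uniform_limit K (\<lambda>n. zeta (G n) (u n)) Z sequentially) \<and>
    (\<forall>z\<in>zeta_disc D. \<exists>S.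
       (\<lambda>j. complex_of_real (lim_coeff D G u (Suc j) / real (Suc j)) * z ^ Suc j) sums S \<and>
       Z z = exp S) \<and>
    (\<forall>(H :: ('h, 'w) measure_graph) w.
       is_measure_graph H \<and> averaging_function H w \<and> weak_limit D G u H w \<longrightarrow>
       (\<forall>z\<in>zeta_disc D. Z z = zeta H w z))"
proof -
  interpret weakly_convergent_sequence D G u by standard (fact assms)+
  define a where "a n j = complex_of_real (enn2real (mean_rcp (G n) (u n) (Suc j)) / real (Suc j))" for n j
  define b where "b j = complex_of_real (lim_coeff D G u (Suc j) / real (Suc j))" for j
  define F where "F z = (\<Sum>j. b j * z ^ Suc j)" for z
  obtain C where mean: "eventually (\<lambda>n. \<forall>j. enn2real (mean_rcp (G n) (u n) (Suc j))
      \<le> C * real D * real (D - 1) ^ j) sequentially"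
    by (rule mean_rcp_bound)
  have a_bound: "eventually (\<lambda>n. \<forall>j. norm (a n j) \<le> C * real D * real (D - 1) ^ j) sequentially"
    using mean
  proof eventually_elim
    case (elim n)
    have "norm (a n j) \<le> enn2real (mean_rcp (G n) (u n) (Suc j))" for j
      using divide_left_mono[of 1 "real (Suc j)" "enn2real (mean_rcp (G n) (u n) (Suc j))"]
      by (simp add: a_def norm_divide del: of_nat_Suc)
    then show ?case using elim order_trans by blast
  qed
  have a_lim: "(\<lambda>n. a n j) \<longlonglongrightarrow> b j" for j
    unfolding a_def b_def
    using tendsto_enn2real[OF mean_rcp_tendsto[of "Suc j"] lim_coeff_nonneg]
    by (intro tendsto_of_real tendsto_divide tendsto_const) auto
  have b_bound: "norm (b j) \<le> C * real D * real (D - 1) ^ j" for j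
    by (rule tendsto_upperbound[OF tendsto_norm[OF a_lim]])
      (use a_bound in \<open>auto elim: eventually_mono\<close>)
  have zeta: "zeta (G n) (u n) = (\<lambda>z. exp (\<Sum>j. a n j * z ^ Suc j))" for n
    by (simp add: zeta_def a_def fun_eq_iff)
  have "uniform_limit K (\<lambda>n. zeta (G n) (u n)) (\<lambda>z. exp (F z)) sequentially"
    if K: "compact K" "K \<subseteq> zeta_disc D" for K
  proof -
    obtain \<rho> where \<rho>: "\<rho> \<ge> 0" "\<rho> * real (D - 1) < 1" "K \<subseteq> cball 0 \<rho>"
      using zeta_disc_compact[OF \<open>D > 0\<close> K] .
    have "uniform_limit (cball 0 \<rho>) (\<lambda>n z. \<Sum>j. a n j * z ^ Suc j) F sequentially"
      unfolding F_def
      by (rule uniform_limit_power_series[OF a_lim a_bound summable_geometric_bound[OF \<rho>(1,2)] \<rho>(1)])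
    then have "uniform_limit (cball 0 \<rho>) (\<lambda>n. zeta (G n) (u n)) (\<lambda>z. exp (F z)) sequentially"
      unfolding zeta F_def
      by (rule uniform_limit_exp) (use summable_power_series(2)[OF b_bound _ \<rho>(2)] in auto)
    then show ?thesis using \<rho>(3) by (rule uniform_limit_on_subset)
  qed
  moreover have "(\<lambda>z. exp (F z)) holomorphic_on zeta_disc D"
    unfolding F_def by (intro holomorphic_on_exp' holomorphic_power_series[OF \<open>D > 0\<close> b_bound])
  moreover have "(\<lambda>j. b j * z ^ Suc j) sums F z" if "z \<in> zeta_disc D" for z
    unfolding F_def using that zeta_disc_iff[OF \<open>D > 0\<close>]
      summable_norm_cancel[OF summable_power_series(1)[OF b_bound order_refl, of z]]
    by (intro summable_sums) auto
  moreover have "exp (F z) = zeta H w z"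
    if "is_measure_graph H" "averaging_function H w" "weak_limit D G u H w"
    for H :: "('h, 'w) measure_graph" and w z
  proof -
    have "bounded_measure_graph D H w"
      using that by (simp add: bounded_measure_graph_def weak_limit_def)
    then have "mean_rcp H w j = ennreal (lim_coeff D G u j)" for j
      using that(3) by (rule mean_rcp_weak_limit)
    then show ?thesis by (simp add: zeta_def F_def b_def lim_coeff_nonneg)
  qed
  ultimately show ?thesis unfolding b_def by (intro exI[of _ "\<lambda>z. exp (F z)"]) blast
qed

end
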